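(* Let $\mathcal{C}_0(\Phi)$ be the set of $0$-dimensional layers of the toric arrangement defined by the irreducible root system $\Phi$, and let $V(\Gamma)=\{0,1,\dots,n\}$ be the vertex set of the affine Dynkin diagram $\Gamma$ of $\Phi$. Then $$|\mathcal{C}_0(\Phi)|=\sum_{p\in V(\Gamma)}\frac{|W|}{|W_p|}.$$
   Context: Let $\mathfrak{g}$ be a simple Lie algebra of rank $n$ over $\mathbb{C}$, $\mathfrak{h}$ a Cartan subalgebra, $\Phi\subset\mathfrak{h}^*$ its (irreducible) root system, $\Phi^\vee\subset\mathfrak{h}$ the coroot system, $W$ the Weyl group. Let $\langle\Phi^\vee\rangle$ be the lattice spanned by the coroots and $T=\mathfrak{h}/\langle\Phi^\vee\rangle$, a complex torus of rank $n$. Each root $\alpha$ takes integer values on $\langle\Phi^\vee\rangle$, hence induces a character $e^\alpha:T\to\mathbb{C}/\mathbb{Z}\simeq\mathbb{C}^*$. Put $H_\alpha=\{t\in T: e^\alpha(t)=1\}$. The toric arrangement is $\{H_\alpha:\alpha\in\Phi^+\}$, and its layers are the connected components of intersections of its elements; $\mathcal{C}_0(\Phi)$ is the set of $0$-dimensional layers, i.e. the set of $t\in T$ such that $\{\alpha\in\Phi: e^\alpha(t)=1\}$ has rank $n$. Let $\alpha_1,\dots,\alpha_n$ be simple roots and $\alpha_0$ the lowest root (the opposite of the highest root). The vertices of the affine Dynkin diagram $\Gamma$ correspond to $\alpha_0,\alpha_1,\dots,\alpha_n$ and are identified with the integers $0,\dots,n$. For $p\in V(\Gamma)$, $W_p$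 is the subgroup of $W$ generated by the reflections $s_{\alpha_i}$, $0\le i\le n$, $i\neq p$. *)

theory Defs
  imports
    "HOL-Analysis.Analysis"
    "HOL-Algebra.Bij"
    "HOL-Algebra.Generated_Groups"
    "HOL-Computational_Algebra.Group_Closure"
begin

text \<open>
  Conventions.  The root system of rank \<open>n = CARD('n)\<close> lives in the Euclidean space
  \<open>real ^ 'n\<close>, the real span of the roots with a Weyl-invariant inner product and an
  orthonormal basis chosen.  The Cartan subalgebra \<open>\<hh>\<close> is \<open>complex ^ 'n\<close> in the dual
  coordinates, so that a root acts on \<open>\<hh>\<close> by the complex bilinear extension of the
  standard pairing.
\<close>

section \<open>Root systems\<close>

definition reflection :: "real ^ 'n \<Rightarrow> real ^ 'n \<Rightarrow> real ^ 'n"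
  where "reflection a v = v - (2 * (v \<bullet> a) / (a \<bullet> a)) *\<^sub>R a"

text \<open>Reduced crystallographic root systems.\<close>

definition root_system :: "(real ^ 'n) set \<Rightarrow> bool"
  where "root_system \<Phi> \<longleftrightarrow>
    finite \<Phi> \<and> span \<Phi> = UNIV \<and> 0 \<notin> \<Phi> \<and>
    (\<forall>a\<in>\<Phi>. reflection a ` \<Phi> = \<Phi>) \<and>
    (\<forall>a\<in>\<Phi>. \<forall>b\<in>\<Phi>. 2 * (b \<bullet> a) / (a \<bullet> a) \<in> \<int>) \<and>
    (\<forall>a\<in>\<Phi>. \<forall>c. c *\<^sub>R a \<in> \<Phi> \<longrightarrow> c = 1 \<or> c = -1)"

definition irreducible_root_system :: "(real ^ 'n) set \<Rightarrow> bool"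
  where "irreducible_root_system \<Phi> \<longleftrightarrow>
    root_system \<Phi> \<and> \<Phi> \<noteq> {} \<and>
    \<not> (\<exists>A B. A \<noteq> {} \<and> B \<noteq> {} \<and> A \<inter> B = {} \<and> A \<union> B = \<Phi> \<and> (\<forall>a\<in>A. \<forall>b\<in>B. a \<bullet> b = 0))"

definition reflection_group :: "(real ^ 'n) set \<Rightarrow> (real ^ 'n \<Rightarrow> real ^ 'n) set"
  where "reflection_group A = generate (BijGroup UNIV) (reflection ` A)"

abbreviation Weyl_group :: "(real ^ 'n) set \<Rightarrow> (real ^ 'n \<Rightarrow> real ^ 'n) set"
  where "Weyl_group \<Phi> \<equiv> reflection_group \<Phi>"

text \<open>
  The families below are indexed by \<open>0, \<dots>, n\<close>: entries \<open>1, \<dots>, n\<close> are the simple roots and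
  entry \<open>0\<close> is the lowest root.  They are the vertices of the affine Dynkin diagram.
\<close>

definition simple_roots :: "(real ^ 'n) set \<Rightarrow> (nat \<Rightarrow> real ^ 'n) \<Rightarrow> bool"
  where "simple_roots \<Phi> \<alpha> \<longleftrightarrow>
    (\<forall>i\<in>{1..CARD('n)}. \<alpha> i \<in> \<Phi>) \<and>
    inj_on \<alpha> {1..CARD('n)} \<and> independent (\<alpha> ` {1..CARD('n)}) \<and>
    (\<forall>b\<in>\<Phi>. \<exists>c::nat \<Rightarrow> nat.
       b = (\<Sum>i=1..CARD('n). real (c i) *\<^sub>R \<alpha> i) \<or>
       b = - (\<Sum>i=1..CARD('n). real (c i) *\<^sub>R \<alpha> i))"

definition positive_roots :: "(real ^ 'n) set \<Rightarrow> (nat \<Rightarrow> real ^ 'n) \<Rightarrow> (real ^ 'n) set"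
  where "positive_roots \<Phi> \<alpha> =
    {b \<in> \<Phi>. \<exists>c::nat \<Rightarrow> nat. b = (\<Sum>i=1..CARD('n). real (c i) *\<^sub>R \<alpha> i)}"

definition highest_root :: "(real ^ 'n) set \<Rightarrow> (nat \<Rightarrow> real ^ 'n) \<Rightarrow> real ^ 'n \<Rightarrow> bool"
  where "highest_root \<Phi> \<alpha> \<theta> \<longleftrightarrow>
    \<theta> \<in> \<Phi> \<and>
    (\<forall>b\<in>\<Phi>. \<exists>c::nat \<Rightarrow> nat. \<theta> - b = (\<Sum>i=1..CARD('n). real (c i) *\<^sub>R \<alpha> i))"

definition affine_simple_roots :: "(real ^ 'n) set \<Rightarrow> (nat \<Rightarrow> real ^ 'n) \<Rightarrow> bool"
  where "affine_simple_roots \<Phi> \<alpha> \<longleftrightarrow> simple_roots \<Phi> \<alpha> \<and> highest_root \<Phi> \<alpha> (- \<alpha> 0)"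

definition affine_Dynkin_vertices :: "'n itself \<Rightarrow> nat set"
  where "affine_Dynkin_vertices _ = {0..CARD('n)}"

definition vertex_subgroup :: "(nat \<Rightarrow> real ^ 'n) \<Rightarrow> nat \<Rightarrow> (real ^ 'n \<Rightarrow> real ^ 'n) set"
  where "vertex_subgroup \<alpha> p =
    reflection_group (\<alpha> ` (affine_Dynkin_vertices TYPE('n) - {p}))"

section \<open>The torus\<close>

definition pairing :: "real ^ 'n \<Rightarrow> complex ^ 'n \<Rightarrow> complex"
  where "pairing a x = (\<Sum>i\<in>UNIV. complex_of_real (a $ i) * x $ i)"

definition coroot :: "real ^ 'n \<Rightarrow> complex ^ 'n"
  where "coroot a = (\<chi> i. complex_of_real (2 * a $ i / (a \<bullet> a)))"

definition coroot_lattice :: "(real ^ 'n) set \<Rightarrow> (complex ^ 'n) set"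
  where "coroot_lattice \<Phi> = group_closure (coroot ` \<Phi>)"

definition lattice_rel :: "(real ^ 'n) set \<Rightarrow> (complex ^ 'n) rel"
  where "lattice_rel \<Phi> = {(x, y). x - y \<in> coroot_lattice \<Phi>}"

definition torus :: "(real ^ 'n) set \<Rightarrow> (complex ^ 'n) set set"
  where "torus \<Phi> = UNIV // lattice_rel \<Phi>"

definition torus_proj :: "(real ^ 'n) set \<Rightarrow> complex ^ 'n \<Rightarrow> (complex ^ 'n) set"
  where "torus_proj \<Phi> x = lattice_rel \<Phi> `` {x}"

text \<open>
  The quotient topology: for a set \<open>U\<close> of cosets, \<open>\<Union>U\<close> is the preimage of \<open>U\<close> under
  the projection.
\<close>

definition torus_topology :: "(real ^ 'n) set \<Rightarrow> (complex ^ 'n) set topology"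
  where "torus_topology \<Phi> = topology (\<lambda>U. U \<subseteq> torus \<Phi> \<and> open (\<Union>U))"

text \<open>
  The identification of \<open>\<complex>/\<int>\<close> with the multiplicative group is \<open>z \<mapsto> exp (2 \<pi> \<i> z)\<close>.
\<close>

definition root_char :: "real ^ 'n \<Rightarrow> (complex ^ 'n) set \<Rightarrow> complex"
  where "root_char a t = the_elem ((\<lambda>x. exp (2 * of_real pi * \<i> * pairing a x)) ` t)"

section \<open>The toric arrangement and its layers\<close>

definition hypersurface :: "(real ^ 'n) set \<Rightarrow> real ^ 'n \<Rightarrow> (complex ^ 'n) set set"
  where "hypersurface \<Phi> a = {t \<in> torus \<Phi>. root_char a t = 1}"

definition toric_arrangement ::
    "(real ^ 'n) set \<Rightarrow> (nat \<Rightarrow> real ^ 'n) \<Rightarrow> (complex ^ 'n) set set set"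
  where "toric_arrangement \<Phi> \<alpha> = hypersurface \<Phi> ` positive_roots \<Phi> \<alpha>"

definition layers :: "(real ^ 'n) set \<Rightarrow> (nat \<Rightarrow> real ^ 'n) \<Rightarrow> (complex ^ 'n) set set set"
  where "layers \<Phi> \<alpha> =
    (\<Union>\<S>\<in>Pow (toric_arrangement \<Phi> \<alpha>).
       connected_components_of (subtopology (torus_topology \<Phi>) (\<Inter>\<S>)))"

text \<open>
  A layer is a coset of a subtorus; its dimension is the complex dimension of the Lie algebra
  of that subtorus, i.e. of the space of directions along which the layer is invariant.
\<close>

definition layer_dim :: "(real ^ 'n) set \<Rightarrow> (complex ^ 'n) set set \<Rightarrow> nat"
  where "layer_dim \<Phi> L =
    vec.dim {v. \<forall>x c. torus_proj \<Phi> x \<in> L \<longrightarrow> torus_proj \<Phi> (x + c *s v) \<in> L}"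

definition zero_dim_layers ::
    "(real ^ 'n) set \<Rightarrow> (nat \<Rightarrow> real ^ 'n) \<Rightarrow> (complex ^ 'n) set set set"
  where "zero_dim_layers \<Phi> \<alpha> = {L \<in> layers \<Phi> \<alpha>. layer_dim \<Phi> L = 0}"

section \<open>Well-definedness\<close>

lemma equiv_lattice_rel: "equiv UNIV (lattice_rel \<Phi>)"
proof (rule equivI)
  show "refl (lattice_rel \<Phi>)"
    by (auto simp: refl_on_def lattice_rel_def coroot_lattice_def)
  show "sym (lattice_rel \<Phi>)"
  proof (rule symI)
    fix x y assume "(x, y) \<in> lattice_rel \<Phi>"
    then have "- (x - y) \<in> coroot_lattice \<Phi>"
      unfolding coroot_lattice_def group_closure_minus_iff
      by (simp add: lattice_rel_def coroot_lattice_def)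
    then show "(y, x) \<in> lattice_rel \<Phi>" by (simp add: lattice_rel_def)
  qed
  show "trans (lattice_rel \<Phi>)"
  proof (rule transI)
    fix x y z assume "(x, y) \<in> lattice_rel \<Phi>" "(y, z) \<in> lattice_rel \<Phi>"
    then have "(x - y) + (y - z) \<in> coroot_lattice \<Phi>"
      unfolding lattice_rel_def coroot_lattice_def by (intro group_closure_add) auto
    then show "(x, z) \<in> lattice_rel \<Phi>" by (simp add: lattice_rel_def)
  qed
qed auto

lemma torus_disjoint: "\<lbrakk>s \<in> torus \<Phi>; t \<in> torus \<Phi>; x \<in> s; x \<in> t\<rbrakk> \<Longrightarrow> s = t"
  unfolding torus_def using quotient_disj[OF equiv_lattice_rel] by blast

lemma openin_torus_topology:
  "openin (torus_topology \<Phi>) U \<longleftrightarrow> U \<subseteq> torus \<Phi> \<and> open (\<Union>U)"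
proof -
  have "istopology (\<lambda>U. U \<subseteq> torus \<Phi> \<and> open (\<Union>U))"
    unfolding istopology_def
  proof (intro conjI allI impI)
    fix S T assume S: "S \<subseteq> torus \<Phi> \<and> open (\<Union>S)" and T: "T \<subseteq> torus \<Phi> \<and> open (\<Union>T)"
    have "\<Union>(S \<inter> T) = \<Union>S \<inter> \<Union>T"
      using S T torus_disjoint by blast
    then show "open (\<Union>(S \<inter> T))" using S T by auto
  next
    fix K assume K: "\<forall>U\<in>K. U \<subseteq> torus \<Phi> \<and> open (\<Union>U)"
    have "\<Union>(\<Union>K) = (\<Union>U\<in>K. \<Union>U)" by blast
    then show "open (\<Union>(\<Union>K))" using K by auto
  qed blast+
  then show ?thesis by (simp add: torus_topology_def topology_inverse')
qed

lemma topspace_torus_topology: "topspace (torus_topology \<Phi>) = torus \<Phi>"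
proof -
  have "\<Union>(torus \<Phi>) = UNIV"
    unfolding torus_def by (rule Union_quotient[OF equiv_lattice_rel])
  then have "openin (torus_topology \<Phi>) (torus \<Phi>)"
    by (simp add: openin_torus_topology)
  then have "torus \<Phi> \<subseteq> topspace (torus_topology \<Phi>)"
    by (rule openin_subset)
  moreover have "topspace (torus_topology \<Phi>) \<subseteq> torus \<Phi>"
    using openin_topspace[of "torus_topology \<Phi>"] by (simp only: openin_torus_topology)
  ultimately show ?thesis by blast
qed

lemma quotient_map_torus_proj: "quotient_map euclidean (torus_topology \<Phi>) (torus_proj \<Phi>)"
proof -
  have 1: "torus_proj \<Phi> ` UNIV = torus \<Phi>"
    by (auto simp: torus_proj_def torus_def quotient_def)
  have 2: "{x. torus_proj \<Phi> x \<in> U} = \<Union>U" if "U \<subseteq> torus \<Phi>" for U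
  proof safe
    fix x assume "torus_proj \<Phi> x \<in> U"
    moreover have "x \<in> torus_proj \<Phi> x"
      by (simp add: torus_proj_def lattice_rel_def coroot_lattice_def)
    ultimately show "x \<in> \<Union>U" by blast
  next
    fix x s assume s: "x \<in> s" "s \<in> U"
    have "x \<in> torus_proj \<Phi> x"
      by (simp add: torus_proj_def lattice_rel_def coroot_lattice_def)
    moreover have "torus_proj \<Phi> x \<in> torus \<Phi>" "s \<in> torus \<Phi>"
      using 1 s(2) that by auto
    ultimately have "torus_proj \<Phi> x = s"
      using s(1) torus_disjoint by metis
    then show "torus_proj \<Phi> x \<in> U" using s by simp
  qed
  show ?thesis
    unfolding quotient_map_def topspace_torus_topology
    using 1 2 by (simp add: openin_torus_topology)
qed

lemma pairing_coroot:
  "pairing b (coroot a) = complex_of_real (2 * (b \<bullet> a) / (a \<bullet> a))"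
proof -
  have "pairing b (coroot a) = (\<Sum>i\<in>UNIV. complex_of_real (2 / (a \<bullet> a) * (b $ i * a $ i)))"
    unfolding pairing_def coroot_def by (intro sum.cong) (simp_all add: field_simps)
  also have "\<dots> = complex_of_real (2 / (a \<bullet> a) * (b \<bullet> a))"
    by (simp only: inner_vec_def[of b a] sum_distrib_left of_real_sum inner_real_def)
  finally show ?thesis by simp
qed

lemma pairing_lattice_Ints:
  assumes "root_system \<Phi>" "a \<in> \<Phi>" "x \<in> coroot_lattice \<Phi>"
  shows "pairing a x \<in> \<int>"
  using assms(3) unfolding coroot_lattice_def
proof induction
  case (base s)
  show ?case
  proof (cases "s = 0")
    case True
    then show ?thesis by (simp add: pairing_def)
  next
    case False
    then obtain b where b: "b \<in> \<Phi>" "s = coroot b" using base by blast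
    then have "2 * (a \<bullet> b) / (b \<bullet> b) \<in> \<int>" using assms by (auto simp: root_system_def)
    then obtain k where "2 * (a \<bullet> b) / (b \<bullet> b) = of_int k" by (elim Ints_cases)
    then have "pairing a s = of_int k"
      unfolding b(2) pairing_coroot by (metis of_real_of_int_eq)
    then show ?thesis by simp
  qed
next
  case (diff s t)
  have "pairing a (s - t) = pairing a s - pairing a t"
    by (simp add: pairing_def algebra_simps sum_subtractf)
  then show ?case using diff by simp
qed

lemma root_char_torus_proj:
  assumes "root_system \<Phi>" "a \<in> \<Phi>"
  shows "root_char a (torus_proj \<Phi> x) = exp (2 * of_real pi * \<i> * pairing a x)"
proof -
  have x: "x \<in> torus_proj \<Phi> x"
    by (simp add: torus_proj_def lattice_rel_def coroot_lattice_def)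
  have "exp (2 * of_real pi * \<i> * pairing a y) = exp (2 * of_real pi * \<i> * pairing a x)"
    if "y \<in> torus_proj \<Phi> x" for y
  proof -
    have "x - y \<in> coroot_lattice \<Phi>"
      using that by (simp add: torus_proj_def lattice_rel_def)
    then obtain k where "pairing a (x - y) = of_int k"
      using pairing_lattice_Ints[OF assms] Ints_cases by metis
    moreover have "pairing a (x - y) = pairing a x - pairing a y"
      by (simp add: pairing_def algebra_simps sum_subtractf)
    ultimately have "pairing a x = pairing a y + of_int k" by (simp add: algebra_simps)
    then have "2 * of_real pi * \<i> * pairing a x =
        2 * of_real pi * \<i> * pairing a y + (of_int (2 * k) * pi) * \<i>"
      by (simp add: algebra_simps)
    then show ?thesis
      using exp_eq by metis
  qed
  then have "(\<lambda>x. exp (2 * of_real pi * \<i> * pairing a x)) ` torus_proj \<Phi> x =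
      {exp (2 * of_real pi * \<i> * pairing a x)}"
    using x by (intro equalityI subsetI; blast)
  then show ?thesis by (simp add: root_char_def)
qed

end

theory Submission
  imports Defs
begin

text \<open>
  A \<open>0\<close>-dimensional layer is a single point of the torus at which the roots with trivial
  character span (\<open>zero_dim_layers_eq\<close>): if the chosen hypersurfaces do not span, each component is
  invariant under a nonzero direction, and if they do, their intersection is discrete.  Such a point is
  represented by a real vector \<open>x\<close> at which the roots with integer value span.  These vectors
  are the points where affine hyperplanes \<open>a + k = 0\<close>, with \<open>a\<close> a root and \<open>k\<close> an integer,
  meet in a point, that is, the vertices of the alcoves of the affine Weyl group, the semidirect product
  of \<open>W\<close> with the coroot lattice.

  The closed fundamental alcove is a strict fundamental domain for the affine Weyl group, so every such
  vector is equivalent to exactly one of the \<open>n + 1\<close> vertices of this alcove, one opposite to each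
  wall.  Modulo the coroot lattice, the points in question thus form \<open>n + 1\<close> orbits of
  \<open>W\<close>, indexed by the vertices \<open>p\<close> of the affine Dynkin diagram.  The stabilizer of a point
  of the alcove in the affine Weyl group is generated by the reflections in the walls through it; for
  vertex \<open>p\<close> these are the walls with index \<open>i \<noteq> p\<close>, and taking linear parts shows that the
  stabilizer in \<open>W\<close> of its image in the torus is \<open>W\<^sub>p\<close>.  The orbit has
  \<open>|W| / |W\<^sub>p|\<close> elements.

  The facts on the affine Weyl group come from a Coxeter style argument with words.  An affine
  root \<open>a + k\<close> is a vector in \<open>V \<times> \<real>\<close>, and every affine root is, up to sign, a combination with
  natural coefficients of the affine simple roots \<open>\<alpha>\<^sub>1, \<dots>, \<alpha>\<^sub>n, 1 - \<theta>\<close>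
  (\<open>affine_root_cases\<close>).  Hence a simple reflection permutes the other positive affine roots
  (\<open>positive_pullback\<close>), which yields the exchange property, the description of stabilizers
  (\<open>exchange\<close>, \<open>alcove_stabilizer\<close>), the way into the alcove (\<open>move_into_alcove\<close>), and generation
  of the whole group by simple reflections (\<open>generated_by_simple_reflections\<close>).
\<close>

section \<open>Products of reflections\<close>

definition refl_prod :: "(real ^ 'n) list \<Rightarrow> real ^ 'n \<Rightarrow> real ^ 'n"
  where "refl_prod as = foldr (\<lambda>a g. reflection a \<circ> g) as id"

lemma refl_prod_simps [simp]:
  "refl_prod [] = id"
  "refl_prod (a # as) = reflection a \<circ> refl_prod as"
  by (simp_all add: refl_prod_def)

lemma refl_prod_append: "refl_prod (as @ bs) = refl_prod as \<circ> refl_prod bs"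
  by (induction as) auto

lemma linear_reflection: "linear (reflection a)"
  unfolding reflection_def
  by (rule linearI) (simp_all add: inner_add_left algebra_simps add_divide_distrib)

lemma reflection_inner: "reflection a x \<bullet> reflection a y = x \<bullet> y"
  by (cases "a = 0")
    (simp_all add: reflection_def inner_diff_left inner_diff_right inner_commute field_simps)

lemma reflection_involution [simp]: "reflection a (reflection a x) = x"
  by (cases "a = 0") (simp_all add: reflection_def inner_diff_left)

lemma linear_refl_prod: "linear (refl_prod as)"
proof (induction as)
  case Nil
  then show ?case using linear_id by (simp add: id_def)
next
  case (Cons a as)
  then show ?case using linear_compose[OF Cons linear_reflection[of a]] by (simp add: comp_def)
qed

lemma refl_prod_rev: "refl_prod (rev as) (refl_prod as x) = x"
  by (induction as arbitrary: x) (auto simp: refl_prod_append)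

lemma refl_prod_rev': "refl_prod as (refl_prod (rev as) x) = x"
  using refl_prod_rev[of "rev as"] by simp

lemma bij_reflection: "bij (reflection a)"
  by (rule o_bij[of "reflection a"]) (auto simp: fun_eq_iff)

lemma bij_refl_prod: "bij (refl_prod as)"
  by (rule o_bij[of "refl_prod (rev as)"]) (auto simp: fun_eq_iff refl_prod_rev refl_prod_rev')

lemma inv_reflection: "inv_into UNIV (reflection a) = reflection a"
  by (rule inv_unique_comp) (auto simp: fun_eq_iff)

lemma reflection_group_eq:
  "reflection_group A = {refl_prod as |as. set as \<subseteq> A}"
proof (intro equalityI subsetI)
  fix w assume "w \<in> reflection_group A"
  then have "w \<in> generate (BijGroup UNIV) (reflection ` A)"
    by (simp add: reflection_group_def)
  then show "w \<in> {refl_prod as |as. set as \<subseteq> A}"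
  proof induction
    case one
    have "\<one>\<^bsub>BijGroup UNIV\<^esub> = refl_prod []"
      by (auto simp: BijGroup_def restrict_def)
    moreover have "set [] \<subseteq> A" by simp
    ultimately show ?case by blast
  next
    case (incl h)
    then obtain a where "a \<in> A" "h = refl_prod [a]" by auto
    then show ?case by (intro CollectI exI[of _ "[a]"]) simp
  next
    case (inv h)
    then obtain a where a: "a \<in> A" "h = reflection a" by auto
    have "h \<in> Bij UNIV" using a bij_reflection[of a] by (simp add: Bij_def)
    then have "inv\<^bsub>BijGroup UNIV\<^esub> h = reflection a"
      by (simp add: inv_BijGroup a inv_reflection restrict_def)
    then show ?case using a by (intro CollectI exI[of _ "[a]"]) simp
  next
    case (eng h1 h2)
    then obtain as bs where "set as \<subseteq> A" "set bs \<subseteq> A" "h1 = refl_prod as" "h2 = refl_prod bs"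
      by auto
    moreover from this have "h1 \<in> Bij UNIV" "h2 \<in> Bij UNIV"
      using bij_refl_prod by (auto simp: Bij_def)
    ultimately have "h1 \<otimes>\<^bsub>BijGroup UNIV\<^esub> h2 = refl_prod (as @ bs)" "set (as @ bs) \<subseteq> A"
      by (simp_all add: BijGroup_def compose_def refl_prod_append fun_eq_iff restrict_def)
    then show ?case by blast
  qed
next
  fix w assume "w \<in> {refl_prod as |as. set as \<subseteq> A}"
  then obtain as where "w = refl_prod as" "set as \<subseteq> A" by auto
  moreover have "refl_prod as \<in> generate (BijGroup UNIV) (reflection ` A)"
    if "set as \<subseteq> A" for as
    using that
  proof (induction as)
    case Nil
    have "\<one>\<^bsub>BijGroup UNIV\<^esub> = refl_prod []"
      by (auto simp: BijGroup_def restrict_def)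
    then show ?case by (metis generate.one)
  next
    case (Cons a as)
    have "reflection a \<otimes>\<^bsub>BijGroup UNIV\<^esub> refl_prod as \<in> generate (BijGroup UNIV) (reflection ` A)"
      using Cons by (intro generate.eng[OF generate.incl]) auto
    moreover have "reflection a \<otimes>\<^bsub>BijGroup UNIV\<^esub> refl_prod as = refl_prod (a # as)"
      using bij_refl_prod[of as] bij_reflection[of a]
      by (auto simp: BijGroup_def Bij_def compose_def fun_eq_iff restrict_def)
    ultimately show ?case by (simp only: refl_prod_simps)
  qed
  ultimately show "w \<in> reflection_group A" by (simp add: reflection_group_def)
qed

section \<open>Affine functions and affine reflections\<close>

text \<open>
  Affine functions on the real space are kept as pairs (gradient, constant term), so that linear
  combinations of them are computed in the vector space \<open>(real ^ 'n) \<times> real\<close>.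
\<close>

definition aeval :: "(real ^ 'n) \<times> real \<Rightarrow> real ^ 'n \<Rightarrow> real"
  where "aeval f x = fst f \<bullet> x + snd f"

definition real_coroot :: "real ^ 'n \<Rightarrow> real ^ 'n"
  where "real_coroot a = (2 / (a \<bullet> a)) *\<^sub>R a"

definition affine_reflection :: "(real ^ 'n) \<times> real \<Rightarrow> real ^ 'n \<Rightarrow> real ^ 'n"
  where "affine_reflection f x = x - aeval f x *\<^sub>R real_coroot (fst f)"

text \<open>
  Composition with the affine reflection in the zero set of \<open>f\<close>, on the level of pairs; in this
  form it subtracts a multiple of \<open>f\<close>, as \<open>s\<^sub>\<alpha>\<close> does on roots.
\<close>

definition pullback :: "(real ^ 'n) \<times> real \<Rightarrow> (real ^ 'n) \<times> real \<Rightarrow> (real ^ 'n) \<times> real"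
  where "pullback f g = g - (fst g \<bullet> real_coroot (fst f)) *\<^sub>R f"

definition affine_prod :: "((real ^ 'n) \<times> real) list \<Rightarrow> real ^ 'n \<Rightarrow> real ^ 'n"
  where "affine_prod fs = foldr (\<lambda>f g. affine_reflection f \<circ> g) fs id"

lemma affine_prod_simps [simp]:
  "affine_prod [] = id"
  "affine_prod (f # fs) = affine_reflection f \<circ> affine_prod fs"
  by (simp_all add: affine_prod_def)

lemma affine_prod_append: "affine_prod (fs @ gs) = affine_prod fs \<circ> affine_prod gs"
  by (induction fs) auto

lemma aeval_pullback: "aeval (pullback f g) x = aeval g (affine_reflection f x)"
  by (simp add: aeval_def pullback_def affine_reflection_def inner_diff_left inner_diff_right
      algebra_simps)

lemma aeval_uminus: "aeval (- f) x = - aeval f x"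
  by (simp add: aeval_def)

lemma aeval_sum: "aeval (\<Sum>i\<in>A. c i *\<^sub>R f i) x = (\<Sum>i\<in>A. c i * aeval (f i) x)"
  by (induction A rule: infinite_finite_induct)
    (auto simp: aeval_def inner_add_left algebra_simps)

lemma inner_real_coroot_self: "a \<noteq> 0 \<Longrightarrow> a \<bullet> real_coroot a = 2"
  by (simp add: real_coroot_def)

lemma reflection_eq_coroot: "reflection a x = x - (x \<bullet> real_coroot a) *\<^sub>R a"
  by (simp add: reflection_def real_coroot_def)

lemma reflection_eq_coroot': "reflection a x = x - (a \<bullet> x) *\<^sub>R real_coroot a"
  by (simp add: reflection_def real_coroot_def inner_commute)

lemma reflection_self: "reflection a a = - a"
  by (cases "a = 0") (simp_all add: reflection_def scaleR_2)

lemma affine_reflection_involution [simp]: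
  "affine_reflection f (affine_reflection f x) = x"
proof (cases "fst f = 0")
  case False
  then have "aeval f (affine_reflection f x) = - aeval f x"
    by (simp add: affine_reflection_def aeval_def inner_diff_right inner_real_coroot_self
        algebra_simps)
  then show ?thesis by (simp add: affine_reflection_def[of f])
qed (simp add: affine_reflection_def real_coroot_def)

lemma pullback_self: "fst f \<noteq> 0 \<Longrightarrow> pullback f f = - f"
  by (simp add: pullback_def inner_real_coroot_self scaleR_2)

lemma fst_pullback: "fst (pullback f g) = reflection (fst f) (fst g)"
  by (simp add: pullback_def reflection_eq_coroot)

lemma pullback_pullback [simp]: "pullback f (pullback f g) = g"
  by (cases "fst f = 0")
    (simp_all add: pullback_def real_coroot_def inner_diff_left algebra_simps scaleR_2
      flip: scaleR_add_left)

lemma affine_reflection_add: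
  "affine_reflection f (x + y) = reflection (fst f) x + affine_reflection f y"
  by (simp add: affine_reflection_def reflection_eq_coroot' aeval_def inner_add_right algebra_simps)

lemma real_coroot_reflection: "real_coroot (reflection a b) = reflection a (real_coroot b)"
  by (simp add: real_coroot_def reflection_inner linear_scale[OF linear_reflection])

text \<open>
  The familiar \<open>s\<^sub>g s s\<^sub>g = s'\<close>, where \<open>s'\<close> reflects in the image hyperplane.
  Linear reflections are isometries, so they carry coroots to coroots.
\<close>

lemma affine_reflection_conjugate:
  "affine_reflection g (affine_reflection (pullback g f) x) =
   affine_reflection f (affine_reflection g x)"
proof -
  have "affine_reflection (pullback g f) x =
      - (aeval f (affine_reflection g x) *\<^sub>R reflection (fst g) (real_coroot (fst f))) + x"
    by (subst affine_reflection_def)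
      (simp add: aeval_pullback fst_pullback real_coroot_reflection)
  then have "affine_reflection g (affine_reflection (pullback g f) x) =
      - (aeval f (affine_reflection g x) *\<^sub>R real_coroot (fst f)) + affine_reflection g x"
    by (simp only: affine_reflection_add linear_neg[OF linear_reflection]
        linear_scale[OF linear_reflection] reflection_involution)
  then show ?thesis by (simp add: affine_reflection_def[of f])
qed

lemma affine_prod_add:
  "affine_prod fs (x + y) = refl_prod (map fst fs) x + affine_prod fs y"
  by (induction fs) (auto simp: affine_reflection_add)

lemma affine_prod_eq: "affine_prod fs x = refl_prod (map fst fs) x + affine_prod fs 0"
  using affine_prod_add[of fs x 0] by simp

lemma affine_prod_linear_part:
  assumes "affine_prod fs = affine_prod gs"
  shows "refl_prod (map fst fs) = refl_prod (map fst gs)"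
  using affine_prod_eq[of fs] affine_prod_eq[of gs] assms
  by (metis add_right_cancel ext)

lemma affine_prod_rev: "affine_prod (rev fs) (affine_prod fs x) = x"
  by (induction fs arbitrary: x) (auto simp: affine_prod_append)

section \<open>Affine roots\<close>

text \<open>
  Since \<open>\<alpha> 0\<close> is the lowest root \<open>-\<theta>\<close>, entry \<open>0\<close> is \<open>1 - \<theta>\<close>, which vanishes
  on the wall of the fundamental alcove that avoids the origin.
\<close>

definition simple_affine :: "(nat \<Rightarrow> real ^ 'n) \<Rightarrow> nat \<Rightarrow> (real ^ 'n) \<times> real"
  where "simple_affine \<alpha> i = (\<alpha> i, of_bool (i = 0))"

locale affine_root_data =
  fixes \<Phi> :: "(real ^ 'n) set" and \<alpha> :: "nat \<Rightarrow> real ^ 'n"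
  assumes root_system: "root_system \<Phi>"
    and simple_roots: "simple_roots \<Phi> \<alpha>"
    and highest_root: "highest_root \<Phi> \<alpha> (- \<alpha> 0)"
begin

abbreviation \<beta> :: "nat \<Rightarrow> (real ^ 'n) \<times> real"
  where "\<beta> \<equiv> simple_affine \<alpha>"

definition affine_roots :: "((real ^ 'n) \<times> real) set"
  where "affine_roots = {f. fst f \<in> \<Phi> \<and> snd f \<in> \<int>}"

lemma finite_roots: "finite \<Phi>"
  and span_roots: "span \<Phi> = UNIV"
  and root_nonzero: "a \<in> \<Phi> \<Longrightarrow> a \<noteq> 0"
  and reflection_root: "a \<in> \<Phi> \<Longrightarrow> b \<in> \<Phi> \<Longrightarrow> reflection a b \<in> \<Phi>"
  and root_multiple: "a \<in> \<Phi> \<Longrightarrow> c *\<^sub>R a \<in> \<Phi> \<Longrightarrow> c = 1 \<or> c = -1"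
  using root_system by (auto simp: root_system_def)

lemma inner_coroot_Ints: "a \<in> \<Phi> \<Longrightarrow> b \<in> \<Phi> \<Longrightarrow> b \<bullet> real_coroot a \<in> \<int>"
  using root_system by (auto simp: root_system_def real_coroot_def)

lemma uminus_root: "a \<in> \<Phi> \<Longrightarrow> - a \<in> \<Phi>"
  using reflection_root[of a a] by (simp add: reflection_self)

lemma refl_prod_root: "set as \<subseteq> \<Phi> \<Longrightarrow> b \<in> \<Phi> \<Longrightarrow> refl_prod as b \<in> \<Phi>"
  by (induction as) (auto intro: reflection_root)

lemma affine_root_nonzero: "f \<in> affine_roots \<Longrightarrow> fst f \<noteq> 0"
  using root_nonzero by (auto simp: affine_roots_def)

lemma uminus_affine_root: "f \<in> affine_roots \<Longrightarrow> - f \<in> affine_roots"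
  by (auto simp: affine_roots_def uminus_root)

lemma pullback_affine_root:
  assumes "f \<in> affine_roots" "g \<in> affine_roots"
  shows "pullback f g \<in> affine_roots"
  using assms reflection_root inner_coroot_Ints
  by (auto simp: affine_roots_def fst_pullback) (auto simp: pullback_def)

lemma affine_prod_pullback:
  assumes "set fs \<subseteq> affine_roots" "g \<in> affine_roots"
  obtains g' where "g' \<in> affine_roots" "\<And>x. aeval g' x = aeval g (affine_prod fs x)"
proof -
  have "\<exists>g'\<in>affine_roots. \<forall>x. aeval g' x = aeval g (affine_prod fs x)"
    using assms
  proof (induction fs arbitrary: g)
    case Nil
    then show ?case by auto
  next
    case (Cons f fs)
    have "pullback f g \<in> affine_roots" "set fs \<subseteq> affine_roots"
      using Cons.prems by (auto intro: pullback_affine_root)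
    from Cons.IH[OF this(2,1)] show ?case by (simp add: aeval_pullback)
  qed
  then show ?thesis using that by blast
qed

lemma simple_affine_root: "i \<in> {0..CARD('n)} \<Longrightarrow> \<beta> i \<in> affine_roots"
  using simple_roots highest_root uminus_root[of "- \<alpha> 0"]
  by (cases "i = 0") (auto simp: affine_roots_def simple_affine_def simple_roots_def highest_root_def)

lemma vertices_split: "{0..CARD('n)} = insert 0 {1..CARD('n)}" "0 \<notin> {1..CARD('n)}"
  by auto

lemma simple_coeffs_unique:
  assumes "(\<Sum>i=1..CARD('n). c i *\<^sub>R \<alpha> i) = 0" "i \<in> {1..CARD('n)}"
  shows "c i = 0"
proof -
  have inj: "inj_on \<alpha> {1..CARD('n)}" and ind: "independent (\<alpha> ` {1..CARD('n)})"
    using simple_roots by (auto simp: simple_roots_def)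
  have "(\<Sum>v\<in>\<alpha> ` {1..CARD('n)}. c (the_inv_into {1..CARD('n)} \<alpha> v) *\<^sub>R v) = 0"
    using assms(1) by (simp add: sum.reindex[OF inj] the_inv_into_f_f[OF inj] del: One_nat_def)
  then have "c (the_inv_into {1..CARD('n)} \<alpha> (\<alpha> i)) = 0"
    using assms(2) independentD[OF ind _ subset_refl, of "\<lambda>v. c (the_inv_into {1..CARD('n)} \<alpha> v)"]
    by blast
  then show ?thesis using the_inv_into_f_f[OF inj assms(2)] by simp
qed

lemma sum_vertices: "(\<Sum>i\<in>{0..CARD('n)}. g i) = g 0 + (\<Sum>i=1..CARD('n). g i)"
  for g :: "nat \<Rightarrow> 'b::comm_monoid_add"
  unfolding vertices_split(1) by (subst sum.insert) auto

lemma sum_simple_affine: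
  "(\<Sum>i=1..CARD('n). c i *\<^sub>R \<beta> i) = ((\<Sum>i=1..CARD('n). c i *\<^sub>R \<alpha> i), 0)"
proof -
  have "c i *\<^sub>R \<beta> i = (c i *\<^sub>R \<alpha> i, 0)" if "i \<in> {1..CARD('n)}" for i
    using that by (simp add: simple_affine_def)
  then have "(\<Sum>i=1..CARD('n). c i *\<^sub>R \<beta> i) = (\<Sum>i=1..CARD('n). (c i *\<^sub>R \<alpha> i, 0))"
    by (intro sum.cong) auto
  then show ?thesis by (simp add: sum_prod)
qed

lemma simple_affine_coeffs_unique:
  assumes "(\<Sum>i\<in>{0..CARD('n)}. c i *\<^sub>R \<beta> i) = 0" "i \<in> {0..CARD('n)}"
  shows "c i = 0"
proof -
  have 1: "c 0 *\<^sub>R \<beta> 0 + ((\<Sum>i=1..CARD('n). c i *\<^sub>R \<alpha> i), 0) = 0"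
    using assms(1) by (simp only: sum_vertices sum_simple_affine)
  then have 0: "c 0 = 0"
    by (simp add: simple_affine_def prod_eq_iff)
  then have "(\<Sum>i=1..CARD('n). c i *\<^sub>R \<alpha> i) = 0"
    using 1 by (simp add: prod_eq_iff)
  then show ?thesis
    using simple_coeffs_unique[of c i] 0 assms(2) by (cases "i = 0") auto
qed

text \<open>
  The relation \<open>\<Sum> m\<^sub>i \<beta>\<^sub>i = 1\<close> says that \<open>\<theta>\<close> is the sum of the \<open>m\<^sub>i \<alpha>\<^sub>i\<close> over
  \<open>i \<ge> 1\<close>.  Each of these marks is positive because \<open>\<theta> - \<alpha>\<^sub>i\<close> is itself a
  nonnegative combination of the simple roots.
\<close>

lemma highest_root_marks:
  obtains m :: "nat \<Rightarrow> nat" where "\<And>i. i \<in> {0..CARD('n)} \<Longrightarrow> m i \<ge> 1" "m 0 = 1"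
    "(\<Sum>i\<in>{0..CARD('n)}. real (m i) *\<^sub>R \<beta> i) = (0, 1)"
proof -
  have "\<exists>c::nat \<Rightarrow> nat. - \<alpha> 0 - b = (\<Sum>i=1..CARD('n). real (c i) *\<^sub>R \<alpha> i)" if "b \<in> \<Phi>" for b
    using highest_root that by (auto simp: highest_root_def)
  moreover have simple: "\<alpha> i \<in> \<Phi>" if "i \<in> {1..CARD('n)}" for i
    using simple_roots that by (auto simp: simple_roots_def)
  ultimately have "\<exists>c::nat \<Rightarrow> nat. - \<alpha> 0 - \<alpha> p = (\<Sum>i=1..CARD('n). real (c i) *\<^sub>R \<alpha> i)"
    if "p \<in> {1..CARD('n)}" for p using that by blast
  then obtain c :: "nat \<Rightarrow> nat \<Rightarrow> nat" where
    c: "\<And>p. p \<in> {1..CARD('n)} \<Longrightarrow> - \<alpha> 0 - \<alpha> p = (\<Sum>i=1..CARD('n). real (c p i) *\<^sub>R \<alpha> i)"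
    by metis
  define d where "d p i = c p i + of_bool (i = p)" for p i
  have d: "- \<alpha> 0 = (\<Sum>i=1..CARD('n). real (d p i) *\<^sub>R \<alpha> i)" if "p \<in> {1..CARD('n)}" for p
  proof -
    have "(\<Sum>i=1..CARD('n). real (d p i) *\<^sub>R \<alpha> i) =
        (\<Sum>i=1..CARD('n). real (c p i) *\<^sub>R \<alpha> i + of_bool (i = p) *\<^sub>R \<alpha> i)"
      by (simp add: d_def scaleR_add_left)
    also have "\<dots> = (\<Sum>i=1..CARD('n). real (c p i) *\<^sub>R \<alpha> i) + (\<Sum>i=1..CARD('n). of_bool (i = p) *\<^sub>R \<alpha> i)"
      by (rule sum.distrib)
    also have "(\<Sum>i=1..CARD('n). of_bool (i = p) *\<^sub>R \<alpha> i) = (\<Sum>i=1..CARD('n). if i = p then \<alpha> i else 0)"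
      by (rule sum.cong) auto
    also have "\<dots> = \<alpha> p" using that by simp
    finally show ?thesis using c[OF that] by (simp add: algebra_simps)
  qed
  have one: "(1::nat) \<in> {1..CARD('n)}" by (simp add: Suc_leI)
  define m where "m i = (if i = 0 then 1 else d 1 i)" for i
  \<comment> \<open>\<open>d p\<close> lists the coefficients of \<open>\<theta>\<close> read off from \<open>\<theta> - \<alpha>\<^sub>p\<close>, hence is
    visibly positive at \<open>p\<close>; by independence all these lists coincide\<close>
  have eq: "d 1 i = d i i" if i: "i \<in> {1..CARD('n)}" for i
  proof -
    have "(\<Sum>j=1..CARD('n). (real (d 1 j) - real (d i j)) *\<^sub>R \<alpha> j) = 0"
      using d[OF one] d[OF i] by (simp add: scaleR_diff_left sum_subtractf)
    from simple_coeffs_unique[OF this i] show ?thesis by simp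
  qed
  have "m i \<ge> 1" if "i \<in> {0..CARD('n)}" for i
    using that eq[of i] by (auto simp: m_def d_def)
  moreover have "m 0 = 1" by (simp add: m_def)
  moreover have "(\<Sum>i=1..CARD('n). real (m i) *\<^sub>R \<alpha> i) = (\<Sum>i=1..CARD('n). real (d 1 i) *\<^sub>R \<alpha> i)"
    by (rule sum.cong) (auto simp: m_def)
  then have "(\<Sum>i\<in>{0..CARD('n)}. real (m i) *\<^sub>R \<beta> i) = (0, 1)"
    unfolding sum_vertices sum_simple_affine
    by (simp only: d[OF one, symmetric]) (simp add: m_def simple_affine_def)
  ultimately show ?thesis using that by blast
qed

definition nonneg_comb :: "(real ^ 'n) \<times> real \<Rightarrow> bool"
  where "nonneg_comb f \<longleftrightarrow> (\<exists>c::nat \<Rightarrow> nat. f = (\<Sum>i\<in>{0..CARD('n)}. real (c i) *\<^sub>R \<beta> i))"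

lemma nonneg_comb_add: "nonneg_comb f \<Longrightarrow> nonneg_comb g \<Longrightarrow> nonneg_comb (f + g)"
proof -
  assume "nonneg_comb f" "nonneg_comb g"
  then obtain c d :: "nat \<Rightarrow> nat" where
    "f = (\<Sum>i\<in>{0..CARD('n)}. real (c i) *\<^sub>R \<beta> i)" "g = (\<Sum>i\<in>{0..CARD('n)}. real (d i) *\<^sub>R \<beta> i)"
    by (auto simp: nonneg_comb_def)
  then have "f + g = (\<Sum>i\<in>{0..CARD('n)}. real (c i + d i) *\<^sub>R \<beta> i)"
    by (simp add: sum.distrib scaleR_add_left)
  then show ?thesis
    unfolding nonneg_comb_def by (intro exI[of _ "\<lambda>i. c i + d i"])
qed

lemma nonneg_comb_linear:
  assumes "b = (\<Sum>i=1..CARD('n). real (c i) *\<^sub>R \<alpha> i)"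
  shows "nonneg_comb (b, 0)"
  unfolding nonneg_comb_def
proof (intro exI)
  let ?d = "\<lambda>i. if i = 0 then 0 else c i"
  have "(\<Sum>i=1..CARD('n). real (?d i) *\<^sub>R \<beta> i) = (\<Sum>i=1..CARD('n). real (c i) *\<^sub>R \<beta> i)"
    by (rule sum.cong) auto
  then show "(b, 0) = (\<Sum>i\<in>{0..CARD('n)}. real (?d i) *\<^sub>R \<beta> i)"
    unfolding sum_vertices using assms by (simp add: sum_simple_affine del: One_nat_def)
qed

lemma nonneg_comb_const: "nonneg_comb (0, real k)"
proof -
  obtain m :: "nat \<Rightarrow> nat" where "(\<Sum>i\<in>{0..CARD('n)}. real (m i) *\<^sub>R \<beta> i) = (0, 1)"
    using highest_root_marks by metis
  then have "(0, real k) = real k *\<^sub>R (\<Sum>i\<in>{0..CARD('n)}. real (m i) *\<^sub>R \<beta> i)" by simp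
  also have "\<dots> = (\<Sum>i\<in>{0..CARD('n)}. real (k * m i) *\<^sub>R \<beta> i)"
    by (simp only: scaleR_sum_right scaleR_scaleR of_nat_mult)
  finally show ?thesis
    unfolding nonneg_comb_def by (intro exI[of _ "\<lambda>i. k * m i"])
qed

text \<open>
  Every root satisfies \<open>a \<ge> -\<theta>\<close>, so for \<open>k \<ge> 1\<close> the function
  \<open>a + k = (a + \<theta>) + (1 - \<theta>) + (k - 1)\<close> is a sum of three nonnegative combinations.
\<close>

lemma affine_root_pos_const:
  assumes "a \<in> \<Phi>" "k \<ge> 1"
  shows "nonneg_comb (a, real k)"
proof -
  obtain c :: "nat \<Rightarrow> nat" where "- \<alpha> 0 - - a = (\<Sum>i=1..CARD('n). real (c i) *\<^sub>R \<alpha> i)"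
    using highest_root uminus_root[OF assms(1)] unfolding highest_root_def by blast
  then have "nonneg_comb (- \<alpha> 0 + a, 0)" by (intro nonneg_comb_linear) simp
  moreover have "nonneg_comb (\<beta> 0)"
    unfolding nonneg_comb_def sum_vertices
    by (rule exI[of _ "\<lambda>i. of_bool (i = 0)"]) simp
  moreover have "(a, real k) = (- \<alpha> 0 + a, 0) + \<beta> 0 + (0, real (k - 1))"
    using assms(2) by (simp add: simple_affine_def of_nat_diff)
  ultimately show ?thesis using nonneg_comb_add nonneg_comb_const by metis
qed

text \<open>
  The affine simple roots behave like a base of the infinite set of affine roots: this is the
  property from which the theory of the affine Weyl group is derived below.
\<close>

lemma affine_root_cases:
  assumes "f \<in> affine_roots"
  shows "nonneg_comb f \<or> nonneg_comb (- f)"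
proof -
  obtain a k where f: "f = (a, of_int k)" "a \<in> \<Phi>"
    using assms by (cases f) (auto simp: affine_roots_def elim: Ints_cases)
  consider "k \<ge> 1" | "k = 0" | "k \<le> -1" by linarith
  then show ?thesis
  proof cases
    case 1
    then show ?thesis using affine_root_pos_const[of a "nat k"] f by simp
  next
    case 2
    obtain c :: "nat \<Rightarrow> nat" where "a = (\<Sum>i=1..CARD('n). real (c i) *\<^sub>R \<alpha> i) \<or>
        - a = (\<Sum>i=1..CARD('n). real (c i) *\<^sub>R \<alpha> i)"
      using simple_roots f(2) unfolding simple_roots_def by fastforce
    then show ?thesis using nonneg_comb_linear f 2 by auto
  next
    case 3
    then show ?thesis
      using affine_root_pos_const[of "- a" "nat (- k)"] uminus_root f by simp
  qed
qed

text \<open>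
  The marks give the only affine relation between the \<open>n + 1\<close> functions \<open>\<beta>\<^sub>i\<close>, so their
  values at a point can be prescribed subject to it.  This produces both an interior point and the
  vertices of the alcove.
\<close>

lemma barycentric_coordinates:
  fixes m :: "nat \<Rightarrow> nat"
  assumes m: "(\<Sum>i\<in>{0..CARD('n)}. real (m i) *\<^sub>R \<beta> i) = (0, 1)" "m 0 = 1"
    and y: "(\<Sum>i\<in>{0..CARD('n)}. real (m i) * y i) = 1"
  obtains x where "\<And>i. i \<in> {0..CARD('n)} \<Longrightarrow> aeval (\<beta> i) x = y i"
proof -
  have inj: "inj_on \<alpha> {1..CARD('n)}" and ind: "independent (\<alpha> ` {1..CARD('n)})"
    using simple_roots by (auto simp: simple_roots_def)
  obtain g :: "real ^ 'n \<Rightarrow> real" where g: "linear g"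
    "\<forall>v\<in>\<alpha> ` {1..CARD('n)}. g v = y (the_inv_into {1..CARD('n)} \<alpha> v)"
    using linear_independent_extend[OF ind, of "\<lambda>v. y (the_inv_into {1..CARD('n)} \<alpha> v)"] by auto
  define x where "x = adjoint g 1"
  have x: "v \<bullet> x = g v" for v
    using adjoint_works[OF g(1), of v 1] by (simp add: x_def inner_commute)
  have 1: "aeval (\<beta> i) x = y i" if "i \<in> {1..CARD('n)}" for i
    using that g(2) the_inv_into_f_f[OF inj that] by (simp add: aeval_def simple_affine_def x)
  have "aeval (\<Sum>i\<in>{0..CARD('n)}. real (m i) *\<^sub>R \<beta> i) x = 1"
    by (simp add: m aeval_def)
  then have "(\<Sum>i\<in>{0..CARD('n)}. real (m i) * aeval (\<beta> i) x) = (\<Sum>i\<in>{0..CARD('n)}. real (m i) * y i)"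
    by (simp only: aeval_sum y)
  moreover have "(\<Sum>i=1..CARD('n). real (m i) * aeval (\<beta> i) x) = (\<Sum>i=1..CARD('n). real (m i) * y i)"
    using 1 by (intro sum.cong) auto
  ultimately have "aeval (\<beta> 0) x = y 0"
    unfolding sum_vertices using m(2) by simp
  then show ?thesis using 1 by (intro that[of x]) (auto simp: vertices_split)
qed

lemma centre_exists: "\<exists>c. \<forall>i\<in>{0..CARD('n)}. aeval (\<beta> i) c > 0"
proof -
  obtain m :: "nat \<Rightarrow> nat" where m: "\<And>i. i \<in> {0..CARD('n)} \<Longrightarrow> m i \<ge> 1" "m 0 = 1"
    "(\<Sum>i\<in>{0..CARD('n)}. real (m i) *\<^sub>R \<beta> i) = (0, 1)"
    using highest_root_marks by metis
  define y where "y i = 1 / ((real CARD('n) + 1) * real (m i))" for i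
  have "(\<Sum>i\<in>{0..CARD('n)}. real (m i) * y i) = (\<Sum>i\<in>{0..CARD('n)}. 1 / (real CARD('n) + 1))"
  proof (rule sum.cong)
    fix i assume "i \<in> {0..CARD('n)}"
    then have "m i \<noteq> 0" using m(1)[of i] by auto
    then show "real (m i) * y i = 1 / (real CARD('n) + 1)" by (simp add: y_def)
  qed simp
  also have "\<dots> = 1" by simp
  finally obtain x where "\<And>i. i \<in> {0..CARD('n)} \<Longrightarrow> aeval (\<beta> i) x = y i"
    using barycentric_coordinates[of m y] m by metis
  moreover have "y i > 0" if "i \<in> {0..CARD('n)}" for i
    using m(1)[OF that] by (simp add: y_def)
  ultimately show ?thesis by metis
qed

section \<open>The fundamental alcove\<close>

definition centre :: "real ^ 'n"
  where "centre = (SOME c. \<forall>i\<in>{0..CARD('n)}. aeval (\<beta> i) c > 0)"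

definition alcove :: "(real ^ 'n) set"
  where "alcove = {x. \<forall>i\<in>{0..CARD('n)}. aeval (\<beta> i) x \<ge> 0}"

lemma centre_pos: "i \<in> {0..CARD('n)} \<Longrightarrow> aeval (\<beta> i) centre > 0"
  using someI_ex[OF centre_exists] unfolding centre_def by blast

lemma nonneg_comb_alcove: "nonneg_comb f \<Longrightarrow> x \<in> alcove \<Longrightarrow> aeval f x \<ge> 0"
  by (auto simp: nonneg_comb_def alcove_def aeval_sum intro!: sum_nonneg)

lemma nonneg_comb_centre:
  assumes "nonneg_comb f" "f \<noteq> 0"
  shows "aeval f centre > 0"
proof -
  obtain c :: "nat \<Rightarrow> nat" where c: "f = (\<Sum>i\<in>{0..CARD('n)}. real (c i) *\<^sub>R \<beta> i)"
    using assms(1) by (auto simp: nonneg_comb_def)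
  obtain i where i: "i \<in> {0..CARD('n)}" "real (c i) *\<^sub>R \<beta> i \<noteq> 0"
    using assms(2) sum.not_neutral_contains_not_neutral unfolding c by blast
  then have "real (c i) * aeval (\<beta> i) centre > 0" using centre_pos by simp
  moreover have "real (c j) * aeval (\<beta> j) centre \<ge> 0" if "j \<in> {0..CARD('n)}" for j
    using centre_pos[OF that] by simp
  ultimately show ?thesis
    unfolding c aeval_sum using i(1) by (intro sum_pos2[of _ i]) auto
qed

lemma affine_root_centre:
  assumes "f \<in> affine_roots"
  shows "aeval f centre > 0 \<and> nonneg_comb f \<or> aeval f centre < 0 \<and> nonneg_comb (- f)"
proof -
  have "f \<noteq> 0" using affine_root_nonzero[OF assms] by auto
  then show ?thesis
    using affine_root_cases[OF assms] nonneg_comb_centre[of f] nonneg_comb_centre[of "- f"]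
    by (auto simp: aeval_uminus)
qed

lemma negative_root_alcove:
  assumes "f \<in> affine_roots" "aeval f centre < 0" "x \<in> alcove"
  shows "aeval f x \<le> 0"
  using affine_root_centre[OF assms(1)] assms nonneg_comb_alcove[of "- f" x]
  by (auto simp: aeval_uminus)

text \<open>
  A simple reflection permutes the positive affine roots other than its own: it changes only the
  \<open>i\<close>-th coefficient of \<open>f\<close>, so a sign change forces all other coefficients to vanish, and
  then \<open>f\<close> is a multiple of \<open>\<beta>\<^sub>i\<close>, hence equal to it.
\<close>

lemma positive_pullback:
  assumes f: "f \<in> affine_roots" "aeval f centre > 0"
    and i: "i \<in> {0..CARD('n)}" "f \<noteq> \<beta> i"
  shows "aeval (pullback (\<beta> i) f) centre > 0"
proof (rule ccontr)
  assume "\<not> aeval (pullback (\<beta> i) f) centre > 0"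
  moreover have f': "pullback (\<beta> i) f \<in> affine_roots"
    by (rule pullback_affine_root[OF simple_affine_root[OF i(1)] f(1)])
  ultimately have "nonneg_comb (- pullback (\<beta> i) f)"
    using affine_root_centre by blast
  then obtain d :: "nat \<Rightarrow> nat" where
    d: "- pullback (\<beta> i) f = (\<Sum>j\<in>{0..CARD('n)}. real (d j) *\<^sub>R \<beta> j)"
    by (auto simp: nonneg_comb_def)
  obtain c :: "nat \<Rightarrow> nat" where c: "f = (\<Sum>j\<in>{0..CARD('n)}. real (c j) *\<^sub>R \<beta> j)"
    using affine_root_centre[OF f(1)] f(2) by (auto simp: nonneg_comb_def)
  define r where "r = fst f \<bullet> real_coroot (fst (\<beta> i))"
  have "(\<Sum>j\<in>{0..CARD('n)}. (real (c j) + real (d j) - r * of_bool (j = i)) *\<^sub>R \<beta> j) =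
      (\<Sum>j\<in>{0..CARD('n)}. real (c j) *\<^sub>R \<beta> j) + (\<Sum>j\<in>{0..CARD('n)}. real (d j) *\<^sub>R \<beta> j) -
      (\<Sum>j\<in>{0..CARD('n)}. if j = i then r *\<^sub>R \<beta> j else 0)"
    unfolding sum.distrib[symmetric] sum_subtractf[symmetric]
    by (rule sum.cong) (auto simp: algebra_simps)
  also have "\<dots> = f + - pullback (\<beta> i) f -
      (\<Sum>j\<in>{0..CARD('n)}. if j = i then r *\<^sub>R \<beta> j else 0)"
    by (simp only: c[symmetric] d[symmetric])
  also have "(\<Sum>j\<in>{0..CARD('n)}. if j = i then r *\<^sub>R \<beta> j else 0) = r *\<^sub>R \<beta> i"
    using i(1) by simp
  also have "f + - pullback (\<beta> i) f - r *\<^sub>R \<beta> i = 0"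
    by (simp add: pullback_def r_def)
  finally have eq: "(\<Sum>j\<in>{0..CARD('n)}. (real (c j) + real (d j) - r * of_bool (j = i)) *\<^sub>R \<beta> j) = 0" .
  have "c j = 0" if "j \<in> {0..CARD('n)}" "j \<noteq> i" for j
    using simple_affine_coeffs_unique[OF eq that(1)] that(2) by simp
  then have "f = (\<Sum>j\<in>{0..CARD('n)}. if j = i then real (c j) *\<^sub>R \<beta> j else 0)"
    unfolding c by (intro sum.cong) auto
  then have fi: "f = real (c i) *\<^sub>R \<beta> i" using i(1) by simp
  moreover from this have "real (c i) = 1 \<or> real (c i) = - 1"
    using f(1) simple_affine_root[OF i(1)] root_multiple[of "fst (\<beta> i)" "real (c i)"]
    by (auto simp: affine_roots_def)
  ultimately show False using i(2) by auto
qed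

text \<open>
  The exchange property.  Peeling off the letters of the word one by one replaces \<open>f\<close> by its
  pullbacks.  These stay positive until the one that equals the next letter, and
  at that point this letter cancels against the reflection in \<open>f\<close>.
\<close>

lemma exchange:
  assumes "f \<in> affine_roots" "aeval f centre > 0" "set fs \<subseteq> \<beta> ` {0..CARD('n)}"
    "aeval f (affine_prod fs centre) < 0"
  shows "\<exists>gs. set gs \<subseteq> \<beta> ` {0..CARD('n)} \<and> length gs < length fs \<and>
    affine_prod gs = affine_reflection f \<circ> affine_prod fs"
  using assms
proof (induction fs arbitrary: f)
  case Nil
  then show ?case by simp
next
  case (Cons g fs)
  then obtain i where i: "i \<in> {0..CARD('n)}" "g = \<beta> i" by auto
  show ?case
  proof (cases "f = g")
    case True
    then show ?thesis
      using Cons.prems by (intro exI[of _ fs]) (auto simp: fun_eq_iff)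
  next
    case False
    let ?f = "pullback g f"
    have "?f \<in> affine_roots"
      using Cons.prems(1) i simple_affine_root pullback_affine_root by simp
    moreover have "aeval ?f centre > 0"
      using positive_pullback Cons.prems(1,2) False i by simp
    moreover have "aeval ?f (affine_prod fs centre) < 0"
      using Cons.prems(4) by (simp add: aeval_pullback)
    moreover have "set fs \<subseteq> \<beta> ` {0..CARD('n)}" using Cons.prems by simp
    ultimately obtain gs where gs: "set gs \<subseteq> \<beta> ` {0..CARD('n)}" "length gs < length fs"
      "affine_prod gs = affine_reflection ?f \<circ> affine_prod fs"
      using Cons.IH by blast
    then have "affine_prod (g # gs) = affine_reflection f \<circ> affine_prod (g # fs)"
      by (auto simp: fun_eq_iff affine_reflection_conjugate)
    then show ?thesis using gs i by (intro exI[of _ "g # gs"]) auto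
  qed
qed

text \<open>
  The closed alcove is a strict fundamental domain, and stabilizers are generated by the walls
  through the point.  Compare the images of the centre under the word and under its tail, with
  respect to the wall \<open>g\<close> of the first letter.  If the tail has already crossed \<open>g\<close>, exchange gives a
  shorter word.  Otherwise the whole word maps the alcove beyond \<open>g\<close>, so the image of
  \<open>x\<close>, which lies in the alcove, is on \<open>g\<close>; the first letter then fixes it and induction applies to
  the tail.
\<close>

lemma alcove_stabilizer:
  assumes "set fs \<subseteq> \<beta> ` {0..CARD('n)}" "x \<in> alcove" "affine_prod fs x \<in> alcove"
  shows "\<exists>gs. set gs \<subseteq> \<beta> ` {i \<in> {0..CARD('n)}. aeval (\<beta> i) x = 0} \<and>
    affine_prod gs = affine_prod fs"
  using assms
proof (induction "length fs" arbitrary: fs rule: less_induct)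
  case less
  show ?case
  proof (cases fs)
    case Nil
    then show ?thesis by (intro exI[of _ "[]"]) simp
  next
    case (Cons g hs)
    then obtain i where i: "i \<in> {0..CARD('n)}" "g = \<beta> i" and hs: "set hs \<subseteq> \<beta> ` {0..CARD('n)}"
      using less.prems(1) by auto
    have g: "g \<in> affine_roots" using i simple_affine_root by simp
    have g_fs: "aeval g (affine_prod fs y) = - aeval g (affine_prod hs y)" for y
      using affine_root_nonzero[OF g]
      by (simp add: Cons aeval_pullback[symmetric] pullback_self aeval_uminus)
    show ?thesis
    proof (cases "aeval g (affine_prod hs centre) < 0")
      case True
      then obtain gs where "set gs \<subseteq> \<beta> ` {0..CARD('n)}" "length gs < length hs"
        "affine_prod gs = affine_reflection g \<circ> affine_prod hs"
        using exchange[OF g _ hs] i centre_pos by blast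
      then show ?thesis
        using less.hyps[of gs] less.prems by (simp add: Cons)
    next
      case False
      have "set fs \<subseteq> affine_roots" using less.prems(1) simple_affine_root by blast
      then obtain g' where g': "g' \<in> affine_roots" "\<And>y. aeval g' y = aeval g (affine_prod fs y)"
        using affine_prod_pullback g by metis
      have "aeval g' centre < 0"
        using affine_root_centre[OF g'(1)] False g'(2) g_fs by auto
      then have "aeval g (affine_prod fs x) \<le> 0"
        using negative_root_alcove[OF g'(1) _ less.prems(2)] g'(2) by simp
      moreover have "aeval g (affine_prod fs x) \<ge> 0"
        using less.prems(3) i by (auto simp: alcove_def)
      ultimately have zero: "aeval g (affine_prod hs x) = 0" using g_fs[of x] by simp
      then have "affine_prod fs x = affine_prod hs x"
        by (simp add: Cons affine_reflection_def)
      then obtain gs where gs: "set gs \<subseteq> \<beta> ` {i \<in> {0..CARD('n)}. aeval (\<beta> i) x = 0}"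
        "affine_prod gs = affine_prod hs"
        using less.hyps[of hs] less.prems hs by (auto simp: Cons)
      have "affine_prod gs x = x"
        using gs(1) by (induction gs) (auto simp: affine_reflection_def)
      then have "aeval g x = 0" using zero gs(2) by simp
      then show ?thesis
        using gs i by (intro exI[of _ "g # gs"]) (auto simp: Cons)
    qed
  qed
qed

lemma affine_prod_fixes:
  "(\<And>f. f \<in> set fs \<Longrightarrow> aeval f x = 0) \<Longrightarrow> affine_prod fs x = x"
  by (induction fs) (auto simp: affine_reflection_def)

section \<open>Moving points into the alcove\<close>

definition separating_roots :: "real ^ 'n \<Rightarrow> ((real ^ 'n) \<times> real) set"
  where "separating_roots x = {f \<in> affine_roots. aeval f centre > 0 \<and> aeval f x < 0}"

text \<open>
  For each of the finitely many gradients the constant term is an integer in a bounded interval.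
\<close>

lemma finite_separating_roots: "finite (separating_roots x)"
proof -
  have "separating_roots x \<subseteq>
      (\<Union>a\<in>\<Phi>. (\<lambda>k. (a, of_int k)) ` {\<lfloor>- (a \<bullet> centre)\<rfloor>..\<lceil>- (a \<bullet> x)\<rceil>})"
  proof
    fix f assume "f \<in> separating_roots x"
    then obtain a k where "f = (a, of_int k)" "a \<in> \<Phi>" "a \<bullet> centre + of_int k > 0" "a \<bullet> x + of_int k < 0"
      by (cases f) (auto simp: separating_roots_def affine_roots_def aeval_def elim!: Ints_cases)
    moreover from this have "k \<in> {\<lfloor>- (a \<bullet> centre)\<rfloor>..\<lceil>- (a \<bullet> x)\<rceil>}"
      by simp linarith
    ultimately show "f \<in> (\<Union>a\<in>\<Phi>. (\<lambda>k. (a, of_int k)) ` {\<lfloor>- (a \<bullet> centre)\<rfloor>..\<lceil>- (a \<bullet> x)\<rceil>})"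
      by blast
  qed
  then show ?thesis by (rule finite_subset) (intro finite_UN_I finite_roots finite_imageI finite_atLeastAtMost_int)
qed

text \<open>
  Reflecting in a violated wall decreases by one the number of hyperplanes that separate the point from the
  centre, since a simple reflection permutes the other positive affine roots.
\<close>

lemma move_into_alcove: "\<exists>fs. set fs \<subseteq> \<beta> ` {0..CARD('n)} \<and> affine_prod fs x \<in> alcove"
proof (induction "card (separating_roots x)" arbitrary: x rule: less_induct)
  case less
  show ?case
  proof (cases "x \<in> alcove")
    case True
    then show ?thesis by (intro exI[of _ "[]"]) simp
  next
    case False
    then obtain i where i: "i \<in> {0..CARD('n)}" "aeval (\<beta> i) x < 0"
      by (auto simp: alcove_def not_le)
    let ?y = "affine_reflection (\<beta> i) x"
    have "pullback (\<beta> i) ` separating_roots ?y \<subseteq> separating_roots x - {\<beta> i}"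
    proof
      fix f assume "f \<in> pullback (\<beta> i) ` separating_roots ?y"
      then obtain h where h: "h \<in> affine_roots" "aeval h centre > 0" "aeval h ?y < 0"
        "f = pullback (\<beta> i) h"
        by (auto simp: separating_roots_def)
      have nz: "fst (\<beta> i) \<noteq> 0"
        using affine_root_nonzero simple_affine_root i(1) by blast
      have neg: "pullback (\<beta> i) (\<beta> i) = - \<beta> i"
        by (rule pullback_self[OF nz])
      have "h \<noteq> \<beta> i"
      proof
        assume "h = \<beta> i"
        then have "aeval (pullback (\<beta> i) (\<beta> i)) x < 0" using h(3) by (simp add: aeval_pullback)
        then show False using i(2) by (simp add: neg aeval_uminus)
      qed
      then have "aeval f centre > 0" using positive_pullback h i(1) by simp
      moreover have "f \<in> affine_roots" using h i(1) pullback_affine_root simple_affine_root by simp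
      moreover have "aeval f x < 0" using h by (simp add: aeval_pullback)
      moreover have "f \<noteq> \<beta> i"
      proof
        assume "f = \<beta> i"
        then have "h = - \<beta> i" using h(4) pullback_pullback[of "\<beta> i" h] neg by simp
        then show False using h(2) centre_pos[OF i(1)] by (simp add: aeval_uminus)
      qed
      ultimately show "f \<in> separating_roots x - {\<beta> i}" by (simp add: separating_roots_def)
    qed
    moreover have "inj (pullback (\<beta> i))" by (rule inj_on_inverseI) (rule pullback_pullback)
    ultimately have "card (separating_roots ?y) \<le> card (separating_roots x - {\<beta> i})"
      by (intro card_inj_on_le[of "pullback (\<beta> i)"])
        (auto intro: inj_on_subset finite_separating_roots)
    moreover have "\<beta> i \<in> separating_roots x"
      using i centre_pos simple_affine_root by (simp add: separating_roots_def)
    ultimately have "card (separating_roots ?y) < card (separating_roots x)"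
      using finite_separating_roots[of x] by (metis card_Diff1_less le_less_trans)
    then obtain fs where "set fs \<subseteq> \<beta> ` {0..CARD('n)}" "affine_prod fs ?y \<in> alcove"
      using less by blast
    then show ?thesis
      using i by (intro exI[of _ "fs @ [\<beta> i]"]) (auto simp: affine_prod_append)
  qed
qed

section \<open>The affine Weyl group\<close>

text \<open>
  Induction on the height \<open>\<Sum> c\<^sub>j\<close>.  As \<open>(a, a) > 0\<close> for the gradient \<open>a\<close> of \<open>f\<close>, some simple root with
  \<open>c\<^sub>i > 0\<close> has positive inner product with \<open>a\<close>.  Its reflection lowers the height and, unless \<open>f\<close> is that
  simple root, keeps \<open>f\<close> positive, so the reflection in \<open>f\<close> is a conjugate of one already obtained.
\<close>

lemma affine_root_orbit:
  assumes "f \<in> affine_roots" "f = (\<Sum>j\<in>{0..CARD('n)}. real (c j) *\<^sub>R \<beta> j)"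
  shows "\<exists>fs. set fs \<subseteq> \<beta> ` {0..CARD('n)} \<and> affine_prod fs = affine_reflection f"
  using assms
proof (induction "\<Sum>j\<in>{0..CARD('n)}. c j" arbitrary: f c rule: less_induct)
  case less
  show ?case
  proof (cases "f \<in> \<beta> ` {0..CARD('n)}")
    case True
    then show ?thesis by (intro exI[of _ "[f]"]) auto
  next
    case False
    have "fst f = (\<Sum>j\<in>{0..CARD('n)}. real (c j) *\<^sub>R fst (\<beta> j))"
      unfolding less.prems(2) by (simp add: fst_sum)
    then have "fst f \<bullet> fst f = (\<Sum>j\<in>{0..CARD('n)}. real (c j) * (fst f \<bullet> fst (\<beta> j)))"
      by (metis (mono_tags, lifting) inner_scaleR_right inner_sum_right sum.cong)
    moreover have "fst f \<bullet> fst f > 0" using affine_root_nonzero[OF less.prems(1)] by simp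
    ultimately obtain i where i: "i \<in> {0..CARD('n)}" "real (c i) * (fst f \<bullet> fst (\<beta> i)) > 0"
      by (metis (no_types, lifting) not_less sum_nonpos)
    have b: "\<beta> i \<in> affine_roots" using i(1) simple_affine_root by simp
    define r where "r = fst f \<bullet> real_coroot (fst (\<beta> i))"
    have r: "r > 0"
      using i(2) affine_root_nonzero[OF b]
      by (simp add: r_def real_coroot_def zero_less_mult_iff)
    define f' where "f' = pullback (\<beta> i) f"
    have f': "f' \<in> affine_roots" using pullback_affine_root[OF b less.prems(1)] by (simp add: f'_def)
    have "nonneg_comb f" using less.prems(2) by (auto simp: nonneg_comb_def)
    moreover have "f \<noteq> 0" using affine_root_nonzero[OF less.prems(1)] by auto
    ultimately have "aeval f centre > 0" by (rule nonneg_comb_centre)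
    moreover have "f \<noteq> \<beta> i" using False i(1) by blast
    ultimately have "aeval f' centre > 0"
      using positive_pullback[OF less.prems(1) _ i(1)] by (simp add: f'_def)
    then obtain d :: "nat \<Rightarrow> nat" where d: "f' = (\<Sum>j\<in>{0..CARD('n)}. real (d j) *\<^sub>R \<beta> j)"
      using affine_root_centre[OF f'] by (auto simp: nonneg_comb_def)
    have "(\<Sum>j\<in>{0..CARD('n)}. (real (c j) - real (d j) - r * of_bool (j = i)) *\<^sub>R \<beta> j) =
        f - f' - (\<Sum>j\<in>{0..CARD('n)}. if j = i then r *\<^sub>R \<beta> j else 0)"
      unfolding d less.prems(2) sum_subtractf[symmetric]
      by (rule sum.cong) (auto simp: algebra_simps)
    also have "(\<Sum>j\<in>{0..CARD('n)}. if j = i then r *\<^sub>R \<beta> j else 0) = r *\<^sub>R \<beta> i"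
      using i(1) by simp
    also have "f - f' - r *\<^sub>R \<beta> i = 0"
      by (simp add: pullback_def r_def f'_def)
    finally have sum0:
      "(\<Sum>j\<in>{0..CARD('n)}. (real (c j) - real (d j) - r * of_bool (j = i)) *\<^sub>R \<beta> j) = 0" .
    have eq: "real (c j) - real (d j) - r * of_bool (j = i) = 0" if "j \<in> {0..CARD('n)}" for j
      by (rule simple_affine_coeffs_unique[OF sum0 that])
    have "(\<Sum>j\<in>{0..CARD('n)}. d j) < (\<Sum>j\<in>{0..CARD('n)}. c j)"
    proof (rule sum_strict_mono_ex1)
      show "\<forall>j\<in>{0..CARD('n)}. d j \<le> c j"
      proof
        fix j assume "j \<in> {0..CARD('n)}"
        then show "d j \<le> c j" using eq[of j] r by (cases "j = i") auto
      qed
      show "\<exists>j\<in>{0..CARD('n)}. d j < c j"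
        using eq[OF i(1)] r i(1) by (intro bexI[of _ i]) auto
    qed simp
    then obtain fs where fs: "set fs \<subseteq> \<beta> ` {0..CARD('n)}" "affine_prod fs = affine_reflection f'"
      using less.hyps[OF _ f' d] by blast
    have "affine_prod (\<beta> i # fs @ [\<beta> i]) x = affine_reflection f x" for x
      by (simp add: affine_prod_append fs(2) f'_def affine_reflection_conjugate)
    then show ?thesis
      using fs(1) i(1) by (intro exI[of _ "\<beta> i # fs @ [\<beta> i]"]) auto
  qed
qed

lemma affine_reflection_uminus: "affine_reflection (- f) = affine_reflection f"
  by (rule ext) (simp add: affine_reflection_def aeval_uminus real_coroot_def)

lemma generated_by_simple_reflections:
  assumes "set fs \<subseteq> affine_roots"
  shows "\<exists>gs. set gs \<subseteq> \<beta> ` {0..CARD('n)} \<and> affine_prod gs = affine_prod fs"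
  using assms
proof (induction fs)
  case Nil
  show ?case by (rule exI[of _ "[]"]) simp
next
  case (Cons f fs)
  then obtain gs where gs: "set gs \<subseteq> \<beta> ` {0..CARD('n)}" "affine_prod gs = affine_prod fs" by auto
  have f: "f \<in> affine_roots" using Cons.prems by simp
  have "\<exists>hs. set hs \<subseteq> \<beta> ` {0..CARD('n)} \<and> affine_prod hs = affine_reflection f"
    using affine_root_cases[OF f]
  proof
    assume "nonneg_comb f"
    then show ?thesis using affine_root_orbit[OF f] by (auto simp: nonneg_comb_def)
  next
    assume "nonneg_comb (- f)"
    then obtain c :: "nat \<Rightarrow> nat" where "- f = (\<Sum>j\<in>{0..CARD('n)}. real (c j) *\<^sub>R \<beta> j)"
      by (auto simp: nonneg_comb_def)
    from affine_root_orbit[OF uminus_affine_root[OF f] this] show ?thesis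
      by (simp add: affine_reflection_uminus)
  qed
  then obtain hs where hs: "set hs \<subseteq> \<beta> ` {0..CARD('n)}" "affine_prod hs = affine_reflection f"
    by blast
  show ?case
    using gs hs by (intro exI[of _ "hs @ gs"]) (auto simp: affine_prod_append)
qed

end

section \<open>The coroot lattice\<close>

definition cvec :: "real ^ 'n \<Rightarrow> complex ^ 'n"
  where "cvec x = (\<chi> i. complex_of_real (x $ i))"

lemma cvec_simps:
  "cvec 0 = 0" "cvec (x + y) = cvec x + cvec y" "cvec (x - y) = cvec x - cvec y"
  "cvec (- x) = - cvec x"
  by (simp_all add: cvec_def vec_eq_iff)

lemma coroot_eq_cvec: "coroot a = cvec (real_coroot a)"
  by (simp add: coroot_def cvec_def real_coroot_def vec_eq_iff)

lemma pairing_cvec: "pairing a (cvec x) = complex_of_real (a \<bullet> x)"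
  by (simp add: pairing_def cvec_def inner_vec_def)

lemma cvec_int_multiple:
  assumes "cvec x \<in> group_closure S"
  shows "cvec (of_int k *\<^sub>R x) \<in> group_closure S"
proof (induction k rule: int_induct[where k = 0])
  case base
  then show ?case by (simp add: cvec_simps)
next
  case (step1 i)
  then have "cvec (of_int i *\<^sub>R x) + cvec x \<in> group_closure S"
    using assms by (intro group_closure_add) auto
  then show ?case by (simp add: algebra_simps flip: cvec_simps)
next
  case (step2 i)
  then have "cvec (of_int i *\<^sub>R x) - cvec x \<in> group_closure S"
    using assms by (intro group_closure.diff) auto
  then show ?case by (simp add: algebra_simps flip: cvec_simps)
qed

lemma torus_proj_eq_iff:
  "torus_proj \<Phi> x = torus_proj \<Phi> y \<longleftrightarrow> x - y \<in> coroot_lattice \<Phi>"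
  using eq_equiv_class_iff[OF equiv_lattice_rel, of x y \<Phi>]
  by (simp add: torus_proj_def lattice_rel_def)

lemma span_orthogonal_zero:
  fixes z :: "real ^ 'm"
  assumes "span S = UNIV" "\<And>s. s \<in> S \<Longrightarrow> s \<bullet> z = 0"
  shows "z = 0"
  using orthogonal_to_span[of z S z] assms by (auto simp: orthogonal_def inner_commute)

context affine_root_data
begin

definition real_lattice :: "(real ^ 'n) set"
  where "real_lattice = {x. cvec x \<in> coroot_lattice \<Phi>}"

lemma torus_proj_cvec_eq_iff:
  "torus_proj \<Phi> (cvec x) = torus_proj \<Phi> (cvec y) \<longleftrightarrow> x - y \<in> real_lattice"
  by (simp add: torus_proj_eq_iff real_lattice_def cvec_simps)

lemma zero_lattice: "0 \<in> real_lattice"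
  by (simp add: real_lattice_def coroot_lattice_def cvec_simps)

lemma diff_lattice: "x \<in> real_lattice \<Longrightarrow> y \<in> real_lattice \<Longrightarrow> x - y \<in> real_lattice"
  by (auto simp: real_lattice_def coroot_lattice_def cvec_simps intro: group_closure.diff)

lemma uminus_lattice: "x \<in> real_lattice \<Longrightarrow> - x \<in> real_lattice"
  using diff_lattice[OF zero_lattice, of x] by simp

lemma coroot_multiple_lattice:
  assumes "a \<in> \<Phi>" "k \<in> \<int>"
  shows "k *\<^sub>R real_coroot a \<in> real_lattice"
proof -
  obtain j where "k = of_int j" using assms(2) by (elim Ints_cases)
  moreover have "coroot a \<in> group_closure (coroot ` \<Phi>)"
    using assms(1) by (intro group_closure.base) auto
  ultimately show ?thesis
    using cvec_int_multiple[of "real_coroot a"]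
    unfolding real_lattice_def coroot_lattice_def coroot_eq_cvec by blast
qed

lemma inner_lattice_Ints: "a \<in> \<Phi> \<Longrightarrow> x \<in> real_lattice \<Longrightarrow> a \<bullet> x \<in> \<int>"
  using pairing_lattice_Ints[OF root_system, of a "cvec x"]
  by (auto simp: real_lattice_def pairing_cvec elim!: Ints_cases)

lemma affine_reflection_lattice:
  assumes "f \<in> affine_roots" "x \<in> real_lattice"
  shows "affine_reflection f x \<in> real_lattice"
  unfolding affine_reflection_def
proof (rule diff_lattice[OF assms(2) coroot_multiple_lattice])
  show "fst f \<in> \<Phi>" using assms by (simp add: affine_roots_def)
  show "aeval f x \<in> \<int>"
    using assms inner_lattice_Ints by (auto simp: affine_roots_def aeval_def)
qed

lemma affine_prod_lattice:
  "set fs \<subseteq> affine_roots \<Longrightarrow> x \<in> real_lattice \<Longrightarrow> affine_prod fs x \<in> real_lattice"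
  by (induction fs) (auto intro: affine_reflection_lattice)

lemma affine_prod_linear: "affine_prod (map (\<lambda>a. (a, 0)) as) = refl_prod as"
  by (induction as)
    (auto simp: fun_eq_iff affine_reflection_def aeval_def reflection_eq_coroot')

lemma linear_affine_roots: "set as \<subseteq> \<Phi> \<Longrightarrow> set (map (\<lambda>a. (a, 0)) as) \<subseteq> affine_roots"
  by (auto simp: affine_roots_def)

lemma refl_prod_lattice:
  "set as \<subseteq> \<Phi> \<Longrightarrow> x \<in> real_lattice \<Longrightarrow> refl_prod as x \<in> real_lattice"
  using affine_prod_lattice[OF linear_affine_roots] by (simp add: affine_prod_linear)

text \<open>
  Translation by the coroot of \<open>a\<close> is the product of the reflections in the parallel
  hyperplanes \<open>a = 1\<close> and \<open>a = 0\<close>.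
\<close>

lemma coroot_lattice_translations:
  assumes "z \<in> coroot_lattice \<Phi>"
  shows "\<exists>x fs. z = cvec x \<and> set fs \<subseteq> affine_roots \<and> affine_prod fs = (\<lambda>y. x + y)"
  using assms unfolding coroot_lattice_def
proof induction
  case (base s)
  show ?case
  proof (cases "s = 0")
    case True
    then show ?thesis
      by (intro exI[of _ 0] exI[of _ "[]"]) (auto simp: cvec_simps)
  next
    case False
    then obtain a where a: "a \<in> \<Phi>" "s = cvec (real_coroot a)"
      using base by (auto simp: coroot_eq_cvec)
    have "affine_prod [(a, -1), (a, 0)] y = real_coroot a + y" for y
      using root_nonzero[OF a(1)]
      by (simp add: affine_reflection_def aeval_def inner_diff_right inner_real_coroot_self
          algebra_simps scaleR_2 flip: scaleR_add_left)
    moreover have "set [(a, -1), (a, 0)] \<subseteq> affine_roots"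
      using a(1) by (auto simp: affine_roots_def)
    ultimately show ?thesis using a(2) by blast
  qed
next
  case (diff s t)
  then obtain x fs y gs where *: "s = cvec x" "set fs \<subseteq> affine_roots" "affine_prod fs = (\<lambda>u. x + u)"
    "t = cvec y" "set gs \<subseteq> affine_roots" "affine_prod gs = (\<lambda>u. y + u)"
    by blast
  have "affine_prod (rev gs) u = u - y" for u
    using affine_prod_rev[of gs "u - y"] by (simp add: *)
  then have "affine_prod (fs @ rev gs) = (\<lambda>u. (x - y) + u)"
    by (auto simp: affine_prod_append fun_eq_iff *)
  then show ?case
    using * by (intro exI[of _ "x - y"] exI[of _ "fs @ rev gs"]) (simp add: cvec_simps)
qed

lemma lattice_translation:
  assumes "x \<in> real_lattice"
  obtains fs where "set fs \<subseteq> affine_roots" "affine_prod fs = (\<lambda>y. x + y)"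
proof -
  obtain x' fs where "cvec x = cvec x'" "set fs \<subseteq> affine_roots" "affine_prod fs = (\<lambda>y. x' + y)"
    using coroot_lattice_translations[of "cvec x"] assms by (auto simp: real_lattice_def)
  moreover from this have "x = x'" by (simp add: cvec_def vec_eq_iff)
  ultimately show ?thesis using that by blast
qed

section \<open>Points on hyperplanes of full rank\<close>

text \<open>
  The real points of the universal cover of the torus that lie over the \<open>0\<close>-dimensional layers.
\<close>

definition special_points :: "(real ^ 'n) set"
  where "special_points = {x. span {a \<in> \<Phi>. a \<bullet> x \<in> \<int>} = UNIV}"

lemma special_points_reflection:
  assumes f: "f \<in> affine_roots" and x: "x \<in> special_points"
  shows "affine_reflection f x \<in> special_points"
proof -
  let ?s = "reflection (fst f)"
  have "?s ` {b \<in> \<Phi>. b \<bullet> x \<in> \<int>} \<subseteq> {b \<in> \<Phi>. b \<bullet> affine_reflection f x \<in> \<int>}"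
  proof safe
    fix b assume b: "b \<in> \<Phi>" "b \<bullet> x \<in> \<int>"
    show sb: "?s b \<in> \<Phi>" using b(1) f reflection_root by (simp add: affine_roots_def)
    have "affine_reflection f x = ?s x - snd f *\<^sub>R real_coroot (fst f)"
      by (simp add: affine_reflection_def aeval_def reflection_eq_coroot' algebra_simps)
    then have "?s b \<bullet> affine_reflection f x = b \<bullet> x - snd f * (?s b \<bullet> real_coroot (fst f))"
      by (simp add: inner_diff_right reflection_inner)
    moreover have "?s b \<bullet> real_coroot (fst f) \<in> \<int>" "snd f \<in> \<int>"
      using inner_coroot_Ints[OF _ sb] f by (auto simp: affine_roots_def)
    ultimately show "?s b \<bullet> affine_reflection f x \<in> \<int>" using b(2) by simp
  qed
  moreover have "span (?s ` {b \<in> \<Phi>. b \<bullet> x \<in> \<int>}) = UNIV"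
    using x bij_reflection[of "fst f"]
    by (simp add: linear_span_image[OF linear_reflection] special_points_def bij_is_surj)
  ultimately show ?thesis
    unfolding special_points_def using span_mono by blast
qed

lemma special_points_affine_prod:
  "set fs \<subseteq> affine_roots \<Longrightarrow> x \<in> special_points \<Longrightarrow> affine_prod fs x \<in> special_points"
  by (induction fs) (auto intro: special_points_reflection)

text \<open>
  The relation \<open>\<Sum> m\<^sub>i \<alpha>\<^sub>i = 0\<close>, with all \<open>m\<^sub>i\<close> positive, expresses any one of the
  \<open>n + 1\<close> vectors by the others.
\<close>

lemma span_simple_omit:
  assumes p: "p \<in> {0..CARD('n)}"
  shows "span (\<alpha> ` ({0..CARD('n)} - {p})) = UNIV"
proof -
  let ?S = "span (\<alpha> ` ({0..CARD('n)} - {p}))"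
  obtain m :: "nat \<Rightarrow> nat" where m: "\<And>i. i \<in> {0..CARD('n)} \<Longrightarrow> m i \<ge> 1"
    "(\<Sum>i\<in>{0..CARD('n)}. real (m i) *\<^sub>R \<beta> i) = (0, 1)"
    using highest_root_marks by metis
  have "fst (\<Sum>i\<in>{0..CARD('n)}. real (m i) *\<^sub>R \<beta> i) = 0" by (simp add: m(2))
  then have "(\<Sum>i\<in>{0..CARD('n)}. real (m i) *\<^sub>R \<alpha> i) = 0"
    by (simp add: fst_sum simple_affine_def)
  then have "real (m p) *\<^sub>R \<alpha> p = - (\<Sum>i\<in>{0..CARD('n)} - {p}. real (m i) *\<^sub>R \<alpha> i)"
    using p by (simp add: sum.remove[of _ p] eq_neg_iff_add_eq_0)
  also have "\<dots> \<in> ?S"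
    by (intro span_neg span_sum span_scale span_base) auto
  finally have "(1 / real (m p)) *\<^sub>R (real (m p) *\<^sub>R \<alpha> p) \<in> ?S"
    by (rule span_scale)
  then have "\<alpha> p \<in> ?S" using m(1)[OF p] by simp
  then have simple: "\<alpha> i \<in> ?S" if "i \<in> {0..CARD('n)}" for i
    using that by (cases "i = p") (auto intro: span_base)
  have "\<Phi> \<subseteq> ?S"
  proof
    fix b assume "b \<in> \<Phi>"
    then obtain c :: "nat \<Rightarrow> nat" where "b = (\<Sum>i=1..CARD('n). real (c i) *\<^sub>R \<alpha> i) \<or>
        b = - (\<Sum>i=1..CARD('n). real (c i) *\<^sub>R \<alpha> i)"
      using simple_roots unfolding simple_roots_def by blast
    moreover have "(\<Sum>i=1..CARD('n). real (c i) *\<^sub>R \<alpha> i) \<in> ?S"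
      by (intro span_sum span_scale simple) auto
    ultimately show "b \<in> ?S" using span_neg by blast
  qed
  then show ?thesis using span_roots span_minimal[OF _ subspace_span] by blast
qed

definition alcove_vertex :: "nat \<Rightarrow> real ^ 'n"
  where "alcove_vertex p = (SOME x. x \<in> alcove \<and> (\<forall>i\<in>{0..CARD('n)}. aeval (\<beta> i) x = 0 \<longleftrightarrow> i \<noteq> p))"

lemma alcove_vertex:
  assumes p: "p \<in> {0..CARD('n)}"
  shows "alcove_vertex p \<in> alcove"
    and "\<And>i. i \<in> {0..CARD('n)} \<Longrightarrow> aeval (\<beta> i) (alcove_vertex p) = 0 \<longleftrightarrow> i \<noteq> p"
proof -
  obtain m :: "nat \<Rightarrow> nat" where m: "\<And>i. i \<in> {0..CARD('n)} \<Longrightarrow> m i \<ge> 1" "m 0 = 1"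
    "(\<Sum>i\<in>{0..CARD('n)}. real (m i) *\<^sub>R \<beta> i) = (0, 1)"
    using highest_root_marks by metis
  define y where "y i = (if i = p then 1 / real (m p) else 0)" for i
  have "(\<Sum>i\<in>{0..CARD('n)}. real (m i) * y i) = (\<Sum>i\<in>{0..CARD('n)}. if i = p then 1 else 0)"
    using m(1)[OF p] by (intro sum.cong) (auto simp: y_def)
  then have "(\<Sum>i\<in>{0..CARD('n)}. real (m i) * y i) = 1" using p by simp
  then obtain x where x: "\<And>i. i \<in> {0..CARD('n)} \<Longrightarrow> aeval (\<beta> i) x = y i"
    using barycentric_coordinates[of m y] m(2,3) by blast
  have "y i \<ge> 0" "y i = 0 \<longleftrightarrow> i \<noteq> p" for i
    using m(1)[OF p] by (auto simp: y_def)
  with x have "x \<in> alcove \<and> (\<forall>i\<in>{0..CARD('n)}. aeval (\<beta> i) x = 0 \<longleftrightarrow> i \<noteq> p)"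
    by (auto simp: alcove_def)
  then have "alcove_vertex p \<in> alcove \<and> (\<forall>i\<in>{0..CARD('n)}. aeval (\<beta> i) (alcove_vertex p) = 0 \<longleftrightarrow> i \<noteq> p)"
    unfolding alcove_vertex_def by (rule someI)
  then show "alcove_vertex p \<in> alcove"
    "\<And>i. i \<in> {0..CARD('n)} \<Longrightarrow> aeval (\<beta> i) (alcove_vertex p) = 0 \<longleftrightarrow> i \<noteq> p"
    by auto
qed

lemma alcove_vertex_special:
  assumes p: "p \<in> {0..CARD('n)}"
  shows "alcove_vertex p \<in> special_points"
proof -
  have "\<alpha> ` ({0..CARD('n)} - {p}) \<subseteq> {a \<in> \<Phi>. a \<bullet> alcove_vertex p \<in> \<int>}"
  proof safe
    fix i assume i: "i \<in> {0..CARD('n)}" "i \<noteq> p"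
    then have "\<beta> i \<in> affine_roots" "aeval (\<beta> i) (alcove_vertex p) = 0"
      using simple_affine_root alcove_vertex(2)[OF p] by auto
    then show "\<alpha> i \<in> \<Phi>" "\<alpha> i \<bullet> alcove_vertex p \<in> \<int>"
      by (auto simp: affine_roots_def simple_affine_def aeval_def eq_neg_iff_add_eq_0[symmetric])
  qed
  then show ?thesis
    using span_simple_omit[OF p] span_mono unfolding special_points_def by blast
qed

text \<open>
  An affine root that vanishes at a point of the alcove is, up to sign, a nonnegative combination of the
  affine simple roots that vanish there.  Hence the gradients of the latter, indexed by \<open>J\<close>,
  already span, so \<open>J\<close> has at least \<open>n\<close> elements.  It cannot have all \<open>n + 1\<close> because the \<open>\<beta>\<^sub>i\<close> have the
  positive combination \<open>1\<close>.
\<close>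

lemma special_alcove_point:
  assumes x: "x \<in> alcove" "x \<in> special_points"
  shows "\<exists>p\<in>{0..CARD('n)}. x = alcove_vertex p"
proof -
  define J where "J = {i \<in> {0..CARD('n)}. aeval (\<beta> i) x = 0}"
  have "{a \<in> \<Phi>. a \<bullet> x \<in> \<int>} \<subseteq> span (\<alpha> ` J)"
  proof safe
    fix a assume a: "a \<in> \<Phi>" "a \<bullet> x \<in> \<int>"
    define f where "f = (a, - (a \<bullet> x))"
    have f: "f \<in> affine_roots" "aeval f x = 0"
      using a by (auto simp: f_def affine_roots_def aeval_def)
    have *: "fst g \<in> span (\<alpha> ` J)" if g: "nonneg_comb g" "aeval g x = 0" for g
    proof -
      obtain c :: "nat \<Rightarrow> nat" where c: "g = (\<Sum>i\<in>{0..CARD('n)}. real (c i) *\<^sub>R \<beta> i)"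
        using g(1) by (auto simp: nonneg_comb_def)
      have "(\<Sum>i\<in>{0..CARD('n)}. real (c i) * aeval (\<beta> i) x) = 0"
        using g(2) by (simp only: c aeval_sum)
      moreover have "real (c i) * aeval (\<beta> i) x \<ge> 0" if "i \<in> {0..CARD('n)}" for i
        using x(1) that by (auto simp: alcove_def)
      ultimately have zero: "real (c i) * aeval (\<beta> i) x = 0" if "i \<in> {0..CARD('n)}" for i
        using that by (subst (asm) sum_nonneg_eq_0_iff) auto
      have "real (c i) *\<^sub>R \<alpha> i \<in> span (\<alpha> ` J)" if "i \<in> {0..CARD('n)}" for i
      proof (cases "c i = 0")
        case True
        then show ?thesis by (simp add: span_zero)
      next
        case False
        then have "i \<in> J" using zero[OF that] that by (simp add: J_def)
        then show ?thesis by (intro span_scale span_base imageI)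
      qed
      moreover have "fst g = (\<Sum>i\<in>{0..CARD('n)}. real (c i) *\<^sub>R \<alpha> i)"
        unfolding c by (simp add: fst_sum simple_affine_def)
      ultimately show ?thesis by (simp only:) (intro span_sum)
    qed
    have "aeval (- f) x = 0" using f(2) by (simp add: aeval_uminus)
    then have "fst f \<in> span (\<alpha> ` J) \<or> - fst f \<in> span (\<alpha> ` J)"
      using affine_root_cases[OF f(1)] *[of f] *[of "- f"] f(2) by auto
    then show "a \<in> span (\<alpha> ` J)"
      using span_neg[of "- a"] by (auto simp: f_def)
  qed
  then have span: "span (\<alpha> ` J) = UNIV"
    using x(2) span_minimal[OF _ subspace_span] unfolding special_points_def by blast
  obtain m :: "nat \<Rightarrow> nat" where m: "(\<Sum>i\<in>{0..CARD('n)}. real (m i) *\<^sub>R \<beta> i) = (0, 1)"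
    using highest_root_marks by metis
  have "J \<noteq> {0..CARD('n)}"
  proof
    assume "J = {0..CARD('n)}"
    then have "aeval (\<Sum>i\<in>{0..CARD('n)}. real (m i) *\<^sub>R \<beta> i) x = 0"
      unfolding aeval_sum by (intro sum.neutral) (auto simp: J_def)
    then show False by (simp add: m aeval_def)
  qed
  moreover have "J \<subseteq> {0..CARD('n)}" by (auto simp: J_def)
  ultimately obtain p where p: "p \<in> {0..CARD('n)}" "p \<notin> J" by blast
  have "finite J" by (simp add: J_def)
  have "CARD('n) = dim (span (\<alpha> ` J))" by (simp add: span dim_UNIV)
  also have "\<dots> \<le> card (\<alpha> ` J)" using \<open>finite J\<close> by (simp add: dim_le_card')
  also have "\<dots> \<le> card J" by (rule card_image_le[OF \<open>finite J\<close>])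
  finally have "card ({0..CARD('n)} - {p}) \<le> card J" using p(1) by simp
  moreover have "J \<subseteq> {0..CARD('n)} - {p}" using p by (auto simp: J_def)
  ultimately have J: "J = {0..CARD('n)} - {p}" by (metis card_seteq finite_Diff finite_atLeastAtMost)
  have "s \<bullet> (x - alcove_vertex p) = 0" if "s \<in> \<alpha> ` J" for s
  proof -
    from that obtain i where i: "i \<in> J" "s = \<alpha> i" by blast
    then have "aeval (\<beta> i) x = 0" "aeval (\<beta> i) (alcove_vertex p) = 0"
      using alcove_vertex(2)[OF p(1)] J by (auto simp: J_def)
    then show ?thesis by (simp add: aeval_def simple_affine_def i inner_diff_right)
  qed
  then have "x - alcove_vertex p = 0" by (rule span_orthogonal_zero[OF span])
  then show ?thesis using p(1) by auto
qed

section \<open>Counting orbits\<close>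

lemma Weyl_group_eq: "Weyl_group \<Phi> = {refl_prod as |as. set as \<subseteq> \<Phi>}"
  by (rule reflection_group_eq)

text \<open>
  A Weyl group element is linear, so it is determined by its permutation of the spanning set \<open>\<Phi>\<close>.
\<close>

lemma finite_Weyl_group: "finite (Weyl_group \<Phi>)"
proof (rule inj_on_finite)
  show "inj_on (\<lambda>w. restrict w \<Phi>) (Weyl_group \<Phi>)"
  proof (rule inj_onI)
    fix v w assume "v \<in> Weyl_group \<Phi>" "w \<in> Weyl_group \<Phi>" and eq: "restrict v \<Phi> = restrict w \<Phi>"
    then have lin: "linear v" "linear w"
      by (auto simp: Weyl_group_eq linear_refl_prod)
    have "v x = w x" for x
      using linear_eq_on_span[OF lin, of \<Phi> x] fun_cong[OF eq] span_roots
      by (metis UNIV_I restrict_apply')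
    then show "v = w" ..
  qed
  show "(\<lambda>w. restrict w \<Phi>) ` Weyl_group \<Phi> \<subseteq> \<Phi> \<rightarrow>\<^sub>E \<Phi>"
    by (auto simp: Weyl_group_eq refl_prod_root)
  show "finite (\<Phi> \<rightarrow>\<^sub>E \<Phi>)" by (intro finite_PiE finite_roots)
qed

lemma simple_in_roots: "i \<in> {0..CARD('n)} \<Longrightarrow> \<alpha> i \<in> \<Phi>"
  using simple_affine_root[of i] by (simp add: affine_roots_def simple_affine_def)

lemma vertex_subgroup_eq:
  "vertex_subgroup \<alpha> p = {refl_prod as |as. set as \<subseteq> \<alpha> ` ({0..CARD('n)} - {p})}"
  unfolding vertex_subgroup_def affine_Dynkin_vertices_def by (rule reflection_group_eq)

text \<open>
  If \<open>v\<close> and \<open>w\<close> carry the vertices \<open>p\<close> and \<open>q\<close> to the same point of the torus, then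
  \<open>w\<inverse>\<close>, a lattice translation and \<open>v\<close> compose to an element of the affine Weyl group
  which maps vertex \<open>p\<close> to vertex \<open>q\<close>.  Since both lie in the alcove, this element is a
  product of reflections in walls through vertex \<open>p\<close>, and its linear part is
  \<open>w\<inverse> v\<close>.
\<close>

lemma same_orbit:
  assumes p: "p \<in> {0..CARD('n)}" and q: "q \<in> {0..CARD('n)}"
    and as: "set as \<subseteq> \<Phi>" and bs: "set bs \<subseteq> \<Phi>"
    and l: "refl_prod as (alcove_vertex p) - refl_prod bs (alcove_vertex q) \<in> real_lattice"
  shows "p = q" "refl_prod (rev bs @ as) \<in> vertex_subgroup \<alpha> p"
proof -
  let ?l = "refl_prod as (alcove_vertex p) - refl_prod bs (alcove_vertex q)"
  let ?lin = "map (\<lambda>a. (a, 0 :: real))"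
  obtain fs where fs: "set fs \<subseteq> affine_roots" "affine_prod fs = (\<lambda>y. - ?l + y)"
    using lattice_translation[OF uminus_lattice[OF l]] by metis
  let ?gs = "?lin (rev bs) @ fs @ ?lin as"
  have gs: "affine_prod ?gs (alcove_vertex p) = alcove_vertex q"
    by (simp add: affine_prod_append fs(2) affine_prod_linear refl_prod_rev)
  have "set ?gs \<subseteq> affine_roots"
    using fs(1) linear_affine_roots[OF as] linear_affine_roots[OF bs] by auto
  then obtain gs' where gs': "set gs' \<subseteq> \<beta> ` {0..CARD('n)}" "affine_prod gs' = affine_prod ?gs"
    using generated_by_simple_reflections by blast
  then have "affine_prod gs' (alcove_vertex p) \<in> alcove"
    using gs alcove_vertex(1)[OF q] by simp
  then obtain hs where hs: "set hs \<subseteq> \<beta> ` {i \<in> {0..CARD('n)}. aeval (\<beta> i) (alcove_vertex p) = 0}"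
    "affine_prod hs = affine_prod ?gs"
    using alcove_stabilizer[OF gs'(1) alcove_vertex(1)[OF p]] gs'(2) by auto
  have "affine_prod hs (alcove_vertex p) = alcove_vertex p"
    using hs(1) by (intro affine_prod_fixes) auto
  then have "alcove_vertex p = alcove_vertex q" using gs hs(2) by simp
  then show "p = q" using alcove_vertex(2)[OF p p] alcove_vertex(2)[OF q p] by auto
  have "refl_prod (map fst fs) y = y" for y
    using affine_prod_eq[of fs y] by (simp add: fs(2))
  then have "refl_prod (map fst ?gs) = refl_prod (rev bs @ as)"
    by (simp add: refl_prod_append fun_eq_iff comp_def)
  then have "refl_prod (map fst hs) = refl_prod (rev bs @ as)"
    using affine_prod_linear_part[OF hs(2)] by simp
  moreover have "set (map fst hs) \<subseteq> \<alpha> ` ({0..CARD('n)} - {p})"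
  proof
    fix a assume "a \<in> set (map fst hs)"
    then obtain f where f: "f \<in> set hs" "a = fst f" by auto
    then obtain i where "i \<in> {0..CARD('n)}" "aeval (\<beta> i) (alcove_vertex p) = 0" "f = \<beta> i"
      using hs(1) by blast
    then show "a \<in> \<alpha> ` ({0..CARD('n)} - {p})"
      using alcove_vertex(2)[OF p] f(2) by (auto simp: simple_affine_def)
  qed
  ultimately show "refl_prod (rev bs @ as) \<in> vertex_subgroup \<alpha> p"
    unfolding vertex_subgroup_eq by (intro CollectI exI[of _ "map fst hs"]) simp
qed

text \<open>
  The affine reflections with indices \<open>i \<noteq> p\<close> fix vertex \<open>p\<close>, and they differ from their linear
  parts by lattice translations.
\<close>

lemma vertex_subgroup_fixes:
  assumes p: "p \<in> {0..CARD('n)}" and u: "u \<in> vertex_subgroup \<alpha> p"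
  shows "u (alcove_vertex p) - alcove_vertex p \<in> real_lattice"
proof -
  obtain as where "u = refl_prod as" "set as \<subseteq> \<alpha> ` ({0..CARD('n)} - {p})"
    using u by (auto simp: vertex_subgroup_eq)
  moreover from this have "as \<in> map \<alpha> ` lists ({0..CARD('n)} - {p})"
    unfolding lists_image[symmetric] by blast
  then obtain js where "as = map \<alpha> js" "set js \<subseteq> {0..CARD('n)} - {p}"
    by blast
  ultimately have js: "u = refl_prod (map fst (map \<beta> js))" "set js \<subseteq> {0..CARD('n)} - {p}"
    by (simp_all add: simple_affine_def comp_def)
  have "affine_prod (map \<beta> js) (alcove_vertex p) = alcove_vertex p"
    using js(2) alcove_vertex(2)[OF p] by (intro affine_prod_fixes) auto
  then have "alcove_vertex p = u (alcove_vertex p) + affine_prod (map \<beta> js) 0"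
    using affine_prod_eq[of "map \<beta> js" "alcove_vertex p"] js(1) by simp
  then have "u (alcove_vertex p) - alcove_vertex p = - affine_prod (map \<beta> js) 0"
    by (simp add: algebra_simps)
  moreover have "affine_prod (map \<beta> js) 0 \<in> real_lattice"
    using js(2) simple_affine_root by (intro affine_prod_lattice zero_lattice) auto
  ultimately show ?thesis using uminus_lattice by simp
qed

definition orbit_map :: "nat \<Rightarrow> (real ^ 'n \<Rightarrow> real ^ 'n) \<Rightarrow> (complex ^ 'n) set"
  where "orbit_map p w = torus_proj \<Phi> (cvec (w (alcove_vertex p)))"

text \<open>
  The stabilizer of the image of vertex \<open>p\<close> in the torus is \<open>W\<^sub>p\<close>, so the fibres of the orbit
  map are its left cosets.
\<close>

lemma card_orbit_fibre:
  assumes p: "p \<in> {0..CARD('n)}" and w: "w \<in> Weyl_group \<Phi>"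
  shows "card {v \<in> Weyl_group \<Phi>. orbit_map p v = orbit_map p w} = card (vertex_subgroup \<alpha> p)"
proof -
  obtain bs where bs: "w = refl_prod bs" "set bs \<subseteq> \<Phi>" using w by (auto simp: Weyl_group_eq)
  have "{v \<in> Weyl_group \<Phi>. orbit_map p v = orbit_map p w} = (\<lambda>u. w \<circ> u) ` vertex_subgroup \<alpha> p"
  proof (intro equalityI subsetI)
    fix v assume "v \<in> {v \<in> Weyl_group \<Phi>. orbit_map p v = orbit_map p w}"
    then obtain as where as: "v = refl_prod as" "set as \<subseteq> \<Phi>"
      "refl_prod as (alcove_vertex p) - refl_prod bs (alcove_vertex p) \<in> real_lattice"
      by (auto simp: Weyl_group_eq orbit_map_def torus_proj_cvec_eq_iff bs(1))
    have "v = w \<circ> refl_prod (rev bs @ as)"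
      by (simp add: fun_eq_iff refl_prod_append as(1) bs(1) refl_prod_rev')
    then show "v \<in> (\<lambda>u. w \<circ> u) ` vertex_subgroup \<alpha> p"
      using same_orbit(2)[OF p p as(2) bs(2) as(3)] by blast
  next
    fix v assume "v \<in> (\<lambda>u. w \<circ> u) ` vertex_subgroup \<alpha> p"
    then obtain u where u: "u \<in> vertex_subgroup \<alpha> p" "v = w \<circ> u" by blast
    then obtain as where as: "u = refl_prod as" "set as \<subseteq> \<alpha> ` ({0..CARD('n)} - {p})"
      by (auto simp: vertex_subgroup_eq)
    have "v = refl_prod (bs @ as)" by (simp add: u(2) as(1) bs(1) refl_prod_append)
    moreover have "set (bs @ as) \<subseteq> \<Phi>" using bs(2) as(2) simple_in_roots by auto
    ultimately have "v \<in> Weyl_group \<Phi>" unfolding Weyl_group_eq by blast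
    moreover have "w (u (alcove_vertex p) - alcove_vertex p) \<in> real_lattice"
      unfolding bs(1) by (intro refl_prod_lattice bs(2) vertex_subgroup_fixes p u(1))
    then have "v (alcove_vertex p) - w (alcove_vertex p) \<in> real_lattice"
      by (simp add: u(2) bs(1) linear_diff[OF linear_refl_prod])
    ultimately show "v \<in> {v \<in> Weyl_group \<Phi>. orbit_map p v = orbit_map p w}"
      by (simp add: orbit_map_def torus_proj_cvec_eq_iff)
  qed
  moreover have "inj_on (\<lambda>u. w \<circ> u) (vertex_subgroup \<alpha> p)"
    unfolding bs(1) by (rule inj_on_inverseI[where g = "\<lambda>v. refl_prod (rev bs) \<circ> v"])
      (simp add: fun_eq_iff refl_prod_rev)
  ultimately show ?thesis by (simp add: card_image)
qed

lemma card_orbit: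
  assumes p: "p \<in> {0..CARD('n)}"
  shows "real (card (orbit_map p ` Weyl_group \<Phi>)) =
    real (card (Weyl_group \<Phi>)) / real (card (vertex_subgroup \<alpha> p))"
proof -
  have "card (Weyl_group \<Phi>) = (\<Sum>w\<in>Weyl_group \<Phi>. 1)" by simp
  also have "\<dots> = (\<Sum>t\<in>orbit_map p ` Weyl_group \<Phi>. \<Sum>w | w \<in> Weyl_group \<Phi> \<and> orbit_map p w = t. 1)"
    by (rule sum.image_gen[OF finite_Weyl_group])
  also have "\<dots> = (\<Sum>t\<in>orbit_map p ` Weyl_group \<Phi>. card (vertex_subgroup \<alpha> p))"
    using card_orbit_fibre[OF p] by (intro sum.cong) auto
  finally have "card (Weyl_group \<Phi>) =
      card (orbit_map p ` Weyl_group \<Phi>) * card (vertex_subgroup \<alpha> p)" by simp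
  moreover have "id \<in> Weyl_group \<Phi>"
    unfolding Weyl_group_eq by (intro CollectI exI[of _ "[]"]) simp
  then have "card (Weyl_group \<Phi>) \<noteq> 0" using finite_Weyl_group by auto
  ultimately show ?thesis by simp
qed

lemma special_points_orbits:
  "(\<lambda>x. torus_proj \<Phi> (cvec x)) ` special_points =
   (\<Union>p\<in>{0..CARD('n)}. orbit_map p ` Weyl_group \<Phi>)"
proof (intro equalityI subsetI)
  fix t assume "t \<in> (\<lambda>x. torus_proj \<Phi> (cvec x)) ` special_points"
  then obtain x where x: "x \<in> special_points" "t = torus_proj \<Phi> (cvec x)" by blast
  obtain fs where fs: "set fs \<subseteq> \<beta> ` {0..CARD('n)}" "affine_prod fs x \<in> alcove"
    using move_into_alcove by blast
  have fs': "set fs \<subseteq> affine_roots" using fs(1) simple_affine_root by blast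
  obtain p where p: "p \<in> {0..CARD('n)}" "affine_prod fs x = alcove_vertex p"
    using special_alcove_point[OF fs(2) special_points_affine_prod[OF fs' x(1)]] by blast
  have "x = affine_prod (rev fs) (alcove_vertex p)"
    using affine_prod_rev[of fs x] p(2) by simp
  then have "x = refl_prod (map fst (rev fs)) (alcove_vertex p) + affine_prod (rev fs) 0"
    using affine_prod_eq by metis
  then have "x - refl_prod (map fst (rev fs)) (alcove_vertex p) \<in> real_lattice"
    using affine_prod_lattice[of "rev fs" 0] fs' zero_lattice
    by (metis add_diff_cancel_left' set_rev)
  then have "t = orbit_map p (refl_prod (map fst (rev fs)))"
    by (simp add: orbit_map_def x(2) torus_proj_cvec_eq_iff)
  moreover have "set (map fst (rev fs)) \<subseteq> \<Phi>" using fs' by (auto simp: affine_roots_def)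
  then have "refl_prod (map fst (rev fs)) \<in> Weyl_group \<Phi>" unfolding Weyl_group_eq by blast
  ultimately show "t \<in> (\<Union>p\<in>{0..CARD('n)}. orbit_map p ` Weyl_group \<Phi>)"
    using p(1) by blast
next
  fix t assume "t \<in> (\<Union>p\<in>{0..CARD('n)}. orbit_map p ` Weyl_group \<Phi>)"
  then obtain p as where p: "p \<in> {0..CARD('n)}" "set as \<subseteq> \<Phi>" "t = orbit_map p (refl_prod as)"
    by (auto simp: Weyl_group_eq)
  have "refl_prod as (alcove_vertex p) \<in> special_points"
    using special_points_affine_prod[OF linear_affine_roots[OF p(2)] alcove_vertex_special[OF p(1)]]
    by (simp add: affine_prod_linear)
  then show "t \<in> (\<lambda>x. torus_proj \<Phi> (cvec x)) ` special_points"
    by (auto simp: p(3) orbit_map_def)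
qed

lemma card_special_points:
  "real (card ((\<lambda>x. torus_proj \<Phi> (cvec x)) ` special_points)) =
   (\<Sum>p\<in>{0..CARD('n)}. real (card (Weyl_group \<Phi>)) / real (card (vertex_subgroup \<alpha> p)))"
proof -
  have "card (\<Union>p\<in>{0..CARD('n)}. orbit_map p ` Weyl_group \<Phi>) =
      (\<Sum>p\<in>{0..CARD('n)}. card (orbit_map p ` Weyl_group \<Phi>))"
  proof (rule card_UN_disjoint)
    show "\<forall>p\<in>{0..CARD('n)}. \<forall>q\<in>{0..CARD('n)}. p \<noteq> q \<longrightarrow>
        orbit_map p ` Weyl_group \<Phi> \<inter> orbit_map q ` Weyl_group \<Phi> = {}"
    proof (intro ballI impI equals0I)
      fix p q t assume pq: "p \<in> {0..CARD('n)}" "q \<in> {0..CARD('n)}" "p \<noteq> q"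
        and "t \<in> orbit_map p ` Weyl_group \<Phi> \<inter> orbit_map q ` Weyl_group \<Phi>"
      then obtain as bs where "set as \<subseteq> \<Phi>" "set bs \<subseteq> \<Phi>"
        "orbit_map p (refl_prod as) = orbit_map q (refl_prod bs)"
        by (auto simp: Weyl_group_eq)
      then show False
        using same_orbit(1)[OF pq(1,2)] pq(3) by (auto simp: orbit_map_def torus_proj_cvec_eq_iff)
    qed
  qed (auto simp: finite_Weyl_group)
  then show ?thesis
    unfolding special_points_orbits using card_orbit by simp
qed

end

section \<open>Zero-dimensional layers\<close>

lemma inner_Re_pairing: "a \<bullet> (\<chi> i. Re (z $ i)) = Re (pairing a z)"
  by (simp add: pairing_def inner_vec_def)

lemma inner_Im_pairing: "a \<bullet> (\<chi> i. Im (z $ i)) = Im (pairing a z)"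
  by (simp add: pairing_def inner_vec_def)

lemma pairing_diff: "pairing a (x - y) = pairing a x - pairing a y"
  by (simp add: pairing_def algebra_simps sum_subtractf)

lemma pairing_add_scale: "pairing a (x + c *s y) = pairing a x + c * pairing a y"
  by (simp add: pairing_def algebra_simps sum.distrib sum_distrib_left)

lemma pairing_scale: "pairing a (c *s y) = c * pairing a y"
  by (simp add: pairing_def algebra_simps sum_distrib_left)

lemma exp_2pi_eq_1_iff: "exp (2 * of_real pi * \<i> * z) = 1 \<longleftrightarrow> z \<in> \<int>"
proof
  assume "exp (2 * of_real pi * \<i> * z) = 1"
  then obtain k :: int where "Im z = 0" "2 * pi * Re z = of_int (2 * k) * pi"
    by (auto simp: exp_eq_1)
  then have "z = of_int k" by (simp add: complex_eq_iff)
  then show "z \<in> \<int>" by simp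
next
  assume "z \<in> \<int>"
  then obtain k where "z = of_int k" by (elim Ints_cases)
  then show "exp (2 * of_real pi * \<i> * z) = 1"
    by (auto simp: exp_eq_1 intro!: exI[of _ k])
qed

lemma torus_proj_in_torus: "torus_proj \<Phi> x \<in> torus \<Phi>"
  by (auto simp: torus_proj_def torus_def quotient_def)

lemma torus_cases:
  assumes "t \<in> torus \<Phi>"
  obtains x where "t = torus_proj \<Phi> x"
  using assms by (auto simp: torus_proj_def torus_def quotient_def)

lemma torus_proj_eq_if_mem: "t \<in> torus \<Phi> \<Longrightarrow> x \<in> t \<Longrightarrow> t = torus_proj \<Phi> x"
  using torus_disjoint[OF _ torus_proj_in_torus, of t \<Phi> x x]
  by (simp add: torus_proj_def lattice_rel_def coroot_lattice_def)

text \<open>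
  Two points of such a set at distance less than \<open>e\<close> have pairings with every \<open>a \<in> S\<close> that are integers
  less than \<open>1\<close> apart, hence equal; since \<open>S\<close> spans, the points are equal.
\<close>

lemma discrete_set_closed:
  assumes S: "finite S" "span S = UNIV" and E: "\<And>x a. x \<in> E \<Longrightarrow> a \<in> S \<Longrightarrow> pairing a x \<in> \<int>"
  shows "closed E"
proof (rule discrete_imp_closed)
  define e where "e = 1 / ((\<Sum>a\<in>S. norm a) + 1)"
  have nonneg: "(\<Sum>a\<in>S. norm a) \<ge> 0" by (intro sum_nonneg) auto
  then show "e > 0" by (simp add: e_def)
  show "\<forall>x\<in>E. \<forall>y\<in>E. dist y x < e \<longrightarrow> y = x"
  proof (intro ballI impI)
    fix x y assume xy: "x \<in> E" "y \<in> E" "dist y x < e"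
    define z where "z = y - x"
    have zero: "Re (pairing a z) = 0 \<and> Im (pairing a z) = 0" if a: "a \<in> S" for a
    proof -
      have "pairing a z \<in> \<int>" using E[OF xy(1) a] E[OF xy(2) a] by (simp add: z_def pairing_diff)
      then obtain k where k: "pairing a z = of_int k" by (elim Ints_cases)
      have "norm (\<chi> i. Re (z $ i)) \<le> norm z"
        unfolding norm_vec_def by (intro L2_set_mono) (auto simp: abs_Re_le_cmod)
      then have "\<bar>Re (pairing a z)\<bar> \<le> norm a * norm z"
        unfolding inner_Re_pairing[symmetric]
        by (meson Cauchy_Schwarz_ineq2 mult_left_mono norm_ge_zero order_trans)
      also have "\<dots> \<le> (\<Sum>a\<in>S. norm a) * norm z"
        using a S(1) by (intro mult_right_mono member_le_sum) auto
      also have "\<dots> \<le> (\<Sum>a\<in>S. norm a) * e"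
        using xy(3) nonneg by (intro mult_left_mono) (auto simp: dist_norm z_def)
      also have "\<dots> < 1" using nonneg by (simp add: e_def)
      finally show ?thesis using k by simp
    qed
    have "(\<chi> i. Re (z $ i)) = 0"
      using zero by (intro span_orthogonal_zero[OF S(2)]) (simp add: inner_Re_pairing)
    moreover have "(\<chi> i. Im (z $ i)) = 0"
      using zero by (intro span_orthogonal_zero[OF S(2)]) (simp add: inner_Im_pairing)
    ultimately have "z = 0" by (simp add: vec_eq_iff complex_eq_iff)
    then show "y = x" by (simp add: z_def)
  qed
qed

context affine_root_data
begin

lemma root_char_eq_1_iff:
  "a \<in> \<Phi> \<Longrightarrow> root_char a (torus_proj \<Phi> x) = 1 \<longleftrightarrow> pairing a x \<in> \<int>"
  by (simp add: root_char_torus_proj[OF root_system] exp_2pi_eq_1_iff)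

definition intersection :: "(real ^ 'n) set \<Rightarrow> (complex ^ 'n) set set"
  where "intersection B = {t \<in> torus \<Phi>. \<forall>a\<in>B. root_char a t = 1}"

lemma torus_proj_intersection_iff:
  "B \<subseteq> \<Phi> \<Longrightarrow> torus_proj \<Phi> x \<in> intersection B \<longleftrightarrow> (\<forall>a\<in>B. pairing a x \<in> \<int>)"
  using root_char_eq_1_iff by (auto simp: intersection_def torus_proj_in_torus)

lemma layers_eq:
  "layers \<Phi> \<alpha> = (\<Union>B\<in>Pow (positive_roots \<Phi> \<alpha>).
     connected_components_of (subtopology (torus_topology \<Phi>) (intersection B)))"
proof -
  have eq: "subtopology (torus_topology \<Phi>) (\<Inter>(hypersurface \<Phi> ` B)) =
      subtopology (torus_topology \<Phi>) (intersection B)" for B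
  proof -
    have "topspace (torus_topology \<Phi>) \<inter> \<Inter>(hypersurface \<Phi> ` B) = intersection B"
      by (auto simp: topspace_torus_topology intersection_def hypersurface_def)
    then show ?thesis by (metis subtopology_restrict)
  qed
  have "Pow (toric_arrangement \<Phi> \<alpha>) = (\<lambda>B. hypersurface \<Phi> ` B) ` Pow (positive_roots \<Phi> \<alpha>)"
    unfolding toric_arrangement_def by (rule image_Pow_surj[symmetric]) simp
  then show ?thesis by (simp add: layers_def eq)
qed

lemma positive_roots_subset: "positive_roots \<Phi> \<alpha> \<subseteq> \<Phi>"
  by (auto simp: positive_roots_def)

lemma positive_roots_cases: "a \<in> \<Phi> \<Longrightarrow> a \<in> positive_roots \<Phi> \<alpha> \<or> - a \<in> positive_roots \<Phi> \<alpha>"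
  using simple_roots uminus_root[of a]
  unfolding simple_roots_def positive_roots_def by fastforce

text \<open>
  A vector \<open>u\<close> orthogonal to \<open>B\<close> does not change the characters from \<open>B\<close>, so each complex line in
  direction \<open>u\<close> that meets \<open>L\<close> is a connected part of the intersection and lies in \<open>L\<close>.
\<close>

lemma zero_dim_spanning:
  assumes B: "B \<subseteq> \<Phi>"
    and L: "L \<in> connected_components_of (subtopology (torus_topology \<Phi>) (intersection B))"
    and dim: "layer_dim \<Phi> L = 0"
  shows "span B = UNIV"
proof (rule ccontr)
  assume "span B \<noteq> UNIV"
  then obtain u where u: "u \<noteq> 0" "\<forall>x\<in>span B. u \<bullet> x = 0"
    using span_not_UNIV_orthogonal by metis
  have pair: "pairing a (cvec u) = 0" if "a \<in> B" for a
    using u(2) span_base[OF that] by (simp add: pairing_cvec inner_commute)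
  have "torus_proj \<Phi> (x + c *s cvec u) \<in> L" if x: "torus_proj \<Phi> x \<in> L" for x c
  proof -
    define K where "K = range (\<lambda>s. x + s *s cvec u)"
    have "L \<subseteq> intersection B"
      using connected_components_of_subset[OF L] by simp
    then have "\<forall>a\<in>B. pairing a x \<in> \<int>"
      using x torus_proj_intersection_iff[OF B] by blast
    then have sub: "torus_proj \<Phi> ` K \<subseteq> intersection B"
      using pair by (auto simp: K_def torus_proj_intersection_iff[OF B] pairing_add_scale)
    have "continuous_on UNIV (\<lambda>s. x + s *s cvec u)"
      unfolding vector_scalar_mult_def by (intro continuous_intros)
    then have "connected K" unfolding K_def by (intro connected_continuous_image) auto
    then have "connectedin (torus_topology \<Phi>) (torus_proj \<Phi> ` K)"
      by (intro connectedin_continuous_map_image[OF quotient_imp_continuous_map[OF quotient_map_torus_proj]])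
        (simp add: connectedin_iff_connected)
    then have "connectedin (subtopology (torus_topology \<Phi>) (intersection B)) (torus_proj \<Phi> ` K)"
      using sub by (simp add: connectedin_subtopology)
    moreover have "torus_proj \<Phi> x \<in> torus_proj \<Phi> ` K"
      unfolding K_def by (intro imageI range_eqI[of _ _ 0]) simp
    then have "\<not> disjnt L (torus_proj \<Phi> ` K)"
      using x by (auto simp: disjnt_def)
    ultimately have "torus_proj \<Phi> ` K \<subseteq> L"
      using connected_components_of_maximal[OF L] by blast
    then show ?thesis by (auto simp: K_def)
  qed
  then have "cvec u \<in> {v. \<forall>x c. torus_proj \<Phi> x \<in> L \<longrightarrow> torus_proj \<Phi> (x + c *s v) \<in> L}" by blast
  then have "cvec u = 0" using dim unfolding layer_dim_def vec.dim_eq_0 by blast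
  then show False using u(1) by (simp add: cvec_def vec_eq_iff)
qed

text \<open>
  Any set of points of the intersection has a closed preimage, by uniform discreteness of the
  preimage of the whole intersection; removing all points but one from it therefore leaves an open point.
\<close>

lemma spanning_intersection_discrete:
  assumes B: "B \<subseteq> \<Phi>" "span B = UNIV"
  shows "subtopology (torus_topology \<Phi>) (intersection B) = discrete_topology (intersection B)"
proof -
  have "openin (subtopology (torus_topology \<Phi>) (intersection B)) {t}" if t: "t \<in> intersection B" for t
    unfolding openin_subtopology
  proof (intro exI conjI)
    let ?V = "torus \<Phi> - (intersection B - {t})"
    show "{t} = ?V \<inter> intersection B"
      using t by (auto simp: intersection_def)
    have "\<Union>?V = - \<Union>(intersection B - {t})"
    proof (intro equalityI subsetI)
      fix x assume "x \<in> - \<Union>(intersection B - {t})"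
      moreover have "x \<in> torus_proj \<Phi> x"
        by (simp add: torus_proj_def lattice_rel_def coroot_lattice_def)
      ultimately show "x \<in> \<Union>?V" using torus_proj_in_torus by blast
    next
      fix x assume "x \<in> \<Union>?V"
      then show "x \<in> - \<Union>(intersection B - {t})"
        using torus_disjoint unfolding intersection_def by fast
    qed
    moreover have "closed (\<Union>(intersection B - {t}))"
    proof (rule discrete_set_closed)
      show "finite B" using B(1) finite_roots by (rule finite_subset)
      show "span B = UNIV" by (rule B(2))
      fix x a assume "x \<in> \<Union>(intersection B - {t})" "a \<in> B"
      then obtain s where s: "s \<in> intersection B" "x \<in> s" by blast
      then have "s = torus_proj \<Phi> x"
        by (intro torus_proj_eq_if_mem) (auto simp: intersection_def)
      then show "pairing a x \<in> \<int>"
        using s(1) \<open>a \<in> B\<close> torus_proj_intersection_iff[OF B(1)] by blast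
    qed
    ultimately show "openin (torus_topology \<Phi>) ?V"
      by (auto simp: openin_torus_topology open_Compl)
  qed
  moreover have "topspace (subtopology (torus_topology \<Phi>) (intersection B)) = intersection B"
    by (auto simp: topspace_torus_topology intersection_def)
  ultimately show ?thesis by (metis discrete_topology_unique)
qed

text \<open>
  A direction \<open>v\<close> that preserves a point has all its multiples in the coroot lattice, on which roots
  take integer values; the multiple by \<open>1 / (2 \<langle>a, v\<rangle>)\<close> would give the value \<open>1 / 2\<close>.
\<close>

lemma point_layer_dim: "layer_dim \<Phi> {torus_proj \<Phi> x} = 0"
proof -
  have "v = 0" if v: "\<forall>y c. torus_proj \<Phi> y \<in> {torus_proj \<Phi> x} \<longrightarrow> torus_proj \<Phi> (y + c *s v) \<in> {torus_proj \<Phi> x}"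
    for v
  proof -
    have int: "c * pairing a v \<in> \<int>" if "a \<in> \<Phi>" for a c
    proof -
      have "torus_proj \<Phi> (x + c *s v) = torus_proj \<Phi> x" using v by blast
      then have "c *s v \<in> coroot_lattice \<Phi>" by (simp add: torus_proj_eq_iff)
      then show ?thesis using pairing_lattice_Ints[OF root_system that] by (metis pairing_scale)
    qed
    have zero: "pairing a v = 0" if a: "a \<in> \<Phi>" for a
    proof (rule ccontr)
      assume "pairing a v \<noteq> 0"
      then have "(1 / 2 :: complex) \<in> \<int>" using int[OF a, of "1 / (2 * pairing a v)"] by simp
      then obtain k where "(1 / 2 :: complex) = of_int k" by (elim Ints_cases)
      then have "(of_int 1 :: complex) = of_int (2 * k)" by (simp add: field_simps)
      then have "1 = 2 * k" by (simp only: of_int_eq_iff)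
      then show False by presburger
    qed
    have "(\<chi> i. Re (v $ i)) = 0"
      using zero by (intro span_orthogonal_zero[OF span_roots]) (simp add: inner_Re_pairing)
    moreover have "(\<chi> i. Im (v $ i)) = 0"
      using zero by (intro span_orthogonal_zero[OF span_roots]) (simp add: inner_Im_pairing)
    ultimately show "v = 0" by (simp add: vec_eq_iff complex_eq_iff)
  qed
  then show ?thesis unfolding layer_dim_def vec.dim_eq_0 by blast
qed

lemma zero_dim_layers_eq:
  "zero_dim_layers \<Phi> \<alpha> = (\<lambda>t. {t}) ` (\<lambda>x. torus_proj \<Phi> (cvec x)) ` special_points"
proof (intro equalityI subsetI)
  fix L assume "L \<in> zero_dim_layers \<Phi> \<alpha>"
  then obtain B where "B \<subseteq> positive_roots \<Phi> \<alpha>" and dim: "layer_dim \<Phi> L = 0"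
    and L: "L \<in> connected_components_of (subtopology (torus_topology \<Phi>) (intersection B))"
    by (auto simp: zero_dim_layers_def layers_eq)
  then have B: "B \<subseteq> \<Phi>" using positive_roots_subset by blast
  have span: "span B = UNIV" by (rule zero_dim_spanning[OF B L dim])
  obtain t where t: "t \<in> intersection B" "L = {t}"
    using L by (auto simp: spanning_intersection_discrete[OF B span] connected_components_of_discrete_topology)
  obtain x where x: "t = torus_proj \<Phi> x"
    using t(1) torus_cases by (auto simp: intersection_def)
  have int: "pairing a x \<in> \<int>" if "a \<in> B" for a
    using t(1) that torus_proj_intersection_iff[OF B] by (simp add: x)
  have "(\<chi> i. Im (x $ i)) = 0"
  proof (rule span_orthogonal_zero[OF span])
    fix a assume "a \<in> B"
    then obtain k where "pairing a x = of_int k" using int by (auto elim: Ints_cases)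
    then show "a \<bullet> (\<chi> i. Im (x $ i)) = 0" by (simp add: inner_Im_pairing)
  qed
  then have "x = cvec (\<chi> i. Re (x $ i))"
    by (simp add: cvec_def vec_eq_iff complex_eq_iff)
  then obtain y where y: "x = cvec y" by blast
  have "B \<subseteq> {a \<in> \<Phi>. a \<bullet> y \<in> \<int>}"
    using B int by (auto simp: y pairing_cvec)
  then have "y \<in> special_points"
    using span span_mono unfolding special_points_def by blast
  then show "L \<in> (\<lambda>t. {t}) ` (\<lambda>x. torus_proj \<Phi> (cvec x)) ` special_points"
    by (auto simp: t(2) x y)
next
  fix L assume "L \<in> (\<lambda>t. {t}) ` (\<lambda>x. torus_proj \<Phi> (cvec x)) ` special_points"
  then obtain y where y: "y \<in> special_points" "L = {torus_proj \<Phi> (cvec y)}" by blast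
  define B where "B = {a \<in> positive_roots \<Phi> \<alpha>. a \<bullet> y \<in> \<int>}"
  have B: "B \<subseteq> \<Phi>" "B \<subseteq> positive_roots \<Phi> \<alpha>"
    using positive_roots_subset by (auto simp: B_def)
  have "{a \<in> \<Phi>. a \<bullet> y \<in> \<int>} \<subseteq> span B"
  proof safe
    fix a assume a: "a \<in> \<Phi>" "a \<bullet> y \<in> \<int>"
    then have "a \<in> B \<or> - a \<in> B" using positive_roots_cases[of a] by (auto simp: B_def)
    then show "a \<in> span B" using span_base[of a B] span_neg[OF span_base[of "- a" B]] by auto
  qed
  then have span: "span B = UNIV"
    using y(1) span_minimal[OF _ subspace_span] unfolding special_points_def by blast
  have "torus_proj \<Phi> (cvec y) \<in> intersection B"
    unfolding torus_proj_intersection_iff[OF B(1)] by (auto simp: B_def pairing_cvec)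
  then have "L \<in> connected_components_of (subtopology (torus_topology \<Phi>) (intersection B))"
    by (auto simp: spanning_intersection_discrete[OF B(1) span]
        connected_components_of_discrete_topology y(2))
  then show "L \<in> zero_dim_layers \<Phi> \<alpha>"
    using B(2) point_layer_dim by (auto simp: zero_dim_layers_def layers_eq y(2))
qed

end

theorem mainTheorem2:
  fixes \<Phi> :: "(real ^ 'n) set" and \<alpha> :: "nat \<Rightarrow> real ^ 'n"
  assumes "irreducible_root_system \<Phi>"
    and "affine_simple_roots \<Phi> \<alpha>"
  shows "real (card (zero_dim_layers \<Phi> \<alpha>)) =
    (\<Sum>p\<in>affine_Dynkin_vertices TYPE('n).
       real (card (Weyl_group \<Phi>)) / real (card (vertex_subgroup \<alpha> p)))"
proof -
  interpret affine_root_data \<Phi> \<alpha>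
    using assms
    by unfold_locales (auto simp: irreducible_root_system_def affine_simple_roots_def)
  have "card (zero_dim_layers \<Phi> \<alpha>) = card ((\<lambda>x. torus_proj \<Phi> (cvec x)) ` special_points)"
    unfolding zero_dim_layers_eq by (rule card_image) auto
  then show ?thesis
    using card_special_points by (simp add: affine_Dynkin_vertices_def)
qed

end
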